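(* Let $\Phi=(A;\{E_i\}_{i=0}^d;A^*;\{E^*_i\}_{i=0}^d)$ be a Leonard system in $\mathcal{A}$ with parameter array $(\{\theta_i\}_{i=0}^d;\{\theta^*_i\}_{i=0}^d;\{\varphi_i\}_{i=1}^d;\{\phi_i\}_{i=1}^d)$, and let $\xi_0\in E_0V$, $\xi_d\in E_dV$, $\xi^*_0\in E^*_0V$, $\xi^*_d\in E^*_dV$ be nonzero vectors. Then (i) and (ii) hold. (i) Let $\{X_i\}_{i=0}^d$ denote one of the sequences $\{E_i\}_{i=0}^d$, $\{E_{d-i}\}_{i=0}^d$, $\{\tau_i(A)\}_{i=0}^d$, $\{\tau_{d-i}(A)\}_{i=0}^d$, $\{\eta_i(A)\}_{i=0}^d$, $\{\eta_{d-i}(A)\}_{i=0}^d$. Then for $0\le i\le d$, \begin{align*} \frac{\langle\xi^*_0,\xi^*_0\rangle}{\langle\xi_0,\xi^*_0\rangle}\sum_{r=0}^d\frac{X_rE^*_0\tau_r(A)}{\varphi_1\varphi_2\cdots\varphi_r}\cdot\tau^*_i(A^* )\xi_0 &= X_i\xi^*_0,\\ \frac{\tau_d(\theta_d)}{\phi}\frac{\langle\xi^*_d,\xi^*_d\rangle}{\langle\xi_0,\xi^*_d\rangle}\sum_{r=0}^dX_rE^*_dE_d\eta^*_{d-r}(A^* )\cdot\tau^*_i(A^* )\xi_0 &= X_i\xi^*_d,\\ \frac{\langle\xi^*_0,\xi^*_0\rangle}{\langle\xi_0,\xi^*_0\rangle}\sum_{r=0}^d\frac{X_{d-r}E^*_0\tau_r(A)}{\varphi_1\varphi_2\cdots\varphi_r}\cdot\tau^*_{d-i}(A^*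 )\xi_0 &= X_i\xi^*_0,\\ \frac{\tau_d(\theta_d)}{\phi}\frac{\langle\xi^*_d,\xi^*_d\rangle}{\langle\xi_0,\xi^*_d\rangle}\sum_{r=0}^dX_{d-r}E^*_dE_d\eta^*_{d-r}(A^* )\cdot\tau^*_{d-i}(A^* )\xi_0 &= X_i\xi^*_d. \end{align*} (ii) Let $\{X_i\}_{i=0}^d$ denote one of the sequences $\{E^*_i\}_{i=0}^d$, $\{E^*_{d-i}\}_{i=0}^d$, $\{\tau^*_i(A^* )\}_{i=0}^d$, $\{\tau^*_{d-i}(A^* )\}_{i=0}^d$, $\{\eta^*_i(A^* )\}_{i=0}^d$, $\{\eta^*_{d-i}(A^* )\}_{i=0}^d$. Then for $0\le i\le d$, \begin{align*} \frac{1}{\mathrm{tr}(E_0E^*_0)}\sum_{r=0}^d\frac{X_rE_0E^*_0\tau_r(A)}{\varphi_1\varphi_2\cdots\varphi_r}\cdot\tau^*_i(A^* )\xi_0 &= X_i\xi_0,\\ \frac{\tau_d(\theta_d)}{\varphi}\frac{\langle\xi_d,\xi^*_0\rangle}{\langle\xi_0,\xi^*_0\rangle}\sum_{r=0}^dX_rE_d\eta^*_{d-r}(A^* )\cdot\tau^*_i(A^* )\xi_0 &= X_i\xi_d,\\ \frac{1}{\mathrm{tr}(E_0E^*_0)}\sum_{r=0}^d\frac{X_{d-r}E_0E^*_0\tau_r(A)}{\varphi_1\varphi_2\cdots\varphi_r}\cdot\tau^*_{d-i}(A^* )\xi_0 &= X_i\xi_0,\\ \frac{\tau_d(\theta_d)}{\varphi}\frac{\langle\xi_d,\xi^*_0\rangle}{\langle\xi_0,\xi^*_0\rangle}\sum_{r=0}^dX_{d-r}E_d\eta^*_{d-r}(A^*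 )\cdot\tau^*_{d-i}(A^* )\xi_0 &= X_i\xi_d. \end{align*}
   Context: Let $\mathbb{K}$ be a field, $d\ge 0$ an integer, $\mathcal{A}$ a $\mathbb{K}$-algebra isomorphic to the algebra $\mathrm{Mat}_{d+1}(\mathbb{K})$ of all $(d+1)\times(d+1)$ matrices over $\mathbb{K}$, $I$ its identity, and $V$ an irreducible left $\mathcal{A}$-module (so $\dim V=d+1$). For $X\in\mathcal{A}$, $\mathrm{tr}(X)$ is the trace of $X$ (equivalently of its action on $V$). Leonard system. An element of $\mathcal{A}$ is multiplicity-free if it has $d+1$ mutually distinct eigenvalues in $\mathbb{K}$. If $A$ is multiplicity-free with eigenvalues $\theta_0,\dots,\theta_d$, the primitive idempotent of $A$ associated with $\theta_i$ is $E_i=\prod_{0\le j\le d,\,j\ne i}\frac{A-\theta_jI}{\theta_i-\theta_j}$ (the projection onto the one-dimensional $\theta_i$-eigenspace $E_iV$). A Leonard system in $\mathcal{A}$ is a sequence $\Phi=(A;\{E_i\}_{i=0}^d;A^*;\{E^*_i\}_{i=0}^d)$ such that: (i) each of $A,A^*$ is a multiplicity-free element of $\mathcal{A}$ ($A^*$ is just another element; no adjoint is meant); (ii) $\{E_i\}_{i=0}^d$ is an ordering of the primitive idempotents of $A$; (iii) $\{E^*_i\}_{i=0}^d$ is an ordering of the primitive idempotents of $A^*$; (iv) for $0\le i,j\le d$, $E_iA^*E_j=0$ if $|i-j|>1$ and $E_iA^*E_j\ne0$ if $|i-j|=1$; (v) for $0\le i,j\le d$, $E^*_iAE^*_j=0$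 if $|i-j|>1$ and $E^*_iAE^*_j\neq0$ if $|i-j|=1$. Parameter array. $\theta_i$ (resp. $\theta^*_i$) is the eigenvalue of $A$ (resp. $A^*$) associated with $E_i$ (resp. $E^*_i$). For $0\le i\le d$ define polynomials $\tau_i=(\lambda-\theta_0)(\lambda-\theta_1)\cdots(\lambda-\theta_{i-1})$, $\eta_i=(\lambda-\theta_d)(\lambda-\theta_{d-1})\cdots(\lambda-\theta_{d-i+1})$, $\tau^*_i=(\lambda-\theta^*_0)(\lambda-\theta^*_1)\cdots(\lambda-\theta^*_{i-1})$, $\eta^*_i=(\lambda-\theta^*_d)(\lambda-\theta^*_{d-1})\cdots(\lambda-\theta^*_{d-i+1})$. For $1\le i\le d$ define $\varphi_i=(\theta^*_0-\theta^*_i)\frac{\mathrm{tr}(\tau_i(A)E^*_0)}{\mathrm{tr}(\tau_{i-1}(A)E^*_0)}$ and $\phi_i=(\theta^*_0-\theta^*_i)\frac{\mathrm{tr}(\eta_i(A)E^*_0)}{\mathrm{tr}(\eta_{i-1}(A)E^*_0)}$; the denominators, and all $\varphi_i,\phi_i$, are known to be nonzero. The parameter array of $\Phi$ is $(\{\theta_i\}_{i=0}^d;\{\theta^*_i\}_{i=0}^d;\{\varphi_i\}_{i=1}^d;\{\phi_i\}_{i=1}^d)$. Abbreviate $\varphi=\varphi_1\varphi_2\cdots\varphi_d$ and $\phi=\phi_1\phi_2\cdots\phi_d$. Empty products are $1$. Bilinear form. There is a unique antiautomorphism $\dagger$ of $\mathcal{A}$ ($\mathbb{K}$-linear bijection with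 $(XY)^\dagger=Y^\dagger X^\dagger$) with $A^\dagger=A$ and $A^{*\dagger}=A^*$. $\langle\,,\rangle$ denotes a fixed nonzero bilinear form on $V$ with $\langle Xu,v\rangle=\langle u,X^\dagger v\rangle$ for all $X\in\mathcal{A}$, $u,v\in V$; it exists, is unique up to a nonzero scalar factor, and is nondegenerate and symmetric. All scalars appearing in denominators (traces and inner products) are known to be nonzero. The notation $T\cdot v$ means the element $T\in\mathcal{A}$ (including the scalar prefactor and the whole sum) applied to $v\in V$. *)

theory Defs
  imports "Jordan_Normal_Form.Char_Poly"
begin

locale field_algebra = vector_space scA
  for scA :: "'k::field \<Rightarrow> 'a::ring_1 \<Rightarrow> 'a" +
  assumes scale_mult_left: "scA c X * Y = scA c (X * Y)"
    and scale_mult_right: "X * scA c Y = scA c (X * Y)"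

definition mat_algebra_iso :: "('k::field \<Rightarrow> 'a::ring_1 \<Rightarrow> 'a) \<Rightarrow> nat \<Rightarrow> ('a \<Rightarrow> 'k mat) \<Rightarrow> bool" where
  "mat_algebra_iso scA n \<rho> \<longleftrightarrow>
     bij_betw \<rho> UNIV (carrier_mat n n) \<and>
     \<rho> 1 = 1\<^sub>m n \<and>
     (\<forall>X Y. \<rho> (X + Y) = \<rho> X + \<rho> Y) \<and>
     (\<forall>X Y. \<rho> (X * Y) = \<rho> X * \<rho> Y) \<and>
     (\<forall>c X. \<rho> (scA c X) = c \<cdot>\<^sub>m \<rho> X)"

locale left_algebra_module =
  field_algebra scA + V: vector_space scV
  for scA :: "'k::field \<Rightarrow> 'a::ring_1 \<Rightarrow> 'a" and scV :: "'k \<Rightarrow> 'v::ab_group_add \<Rightarrow> 'v" +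
  fixes act :: "'a \<Rightarrow> 'v \<Rightarrow> 'v"
  assumes act_one: "act 1 v = v"
    and act_mult: "act (X * Y) v = act X (act Y v)"
    and act_add_left: "act (X + Y) v = act X v + act Y v"
    and act_add_right: "act X (u + v) = act X u + act X v"
    and act_scale: "act (scA c X) v = scV c (act X v)"

locale irreducible_algebra_module = left_algebra_module scA scV act
  for scA :: "'k::field \<Rightarrow> 'a::ring_1 \<Rightarrow> 'a" and scV :: "'k \<Rightarrow> 'v::ab_group_add \<Rightarrow> 'v"
    and act :: "'a \<Rightarrow> 'v \<Rightarrow> 'v" +
  assumes nonzero: "\<exists>v::'v. v \<noteq> 0"
    and irreducible:
      "V.subspace W \<Longrightarrow> (\<And>X w. w \<in> W \<Longrightarrow> act X w \<in> W) \<Longrightarrow> W = {0} \<or> W = UNIV"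

definition poly_alg :: "('k::field \<Rightarrow> 'a::ring_1 \<Rightarrow> 'a) \<Rightarrow> 'k poly \<Rightarrow> 'a \<Rightarrow> 'a" where
  "poly_alg scA p X = (\<Sum>k\<le>degree p. scA (coeff p k) (X ^ k))"

text \<open>
  Trace and eigenvalues of an algebra element are those of its image under a chosen
  isomorphism \<open>\<rho>\<close> onto the full matrix algebra; they do not depend on the choice, since any
  two such isomorphisms are conjugate.
\<close>

definition tr :: "('a \<Rightarrow> 'k::field mat) \<Rightarrow> 'a \<Rightarrow> 'k" where
  "tr \<rho> X = (\<Sum>i<dim_row (\<rho> X). \<rho> X $$ (i, i))"

definition spec :: "('a \<Rightarrow> 'k::field mat) \<Rightarrow> 'a \<Rightarrow> 'k set" where
  "spec \<rho> X = {\<theta>. eigenvalue (\<rho> X) \<theta>}"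

text \<open>\<open>card\<close> of an infinite set is 0, so for \<open>n > 0\<close> this includes finiteness.\<close>

definition multiplicity_free :: "('a \<Rightarrow> 'k::field mat) \<Rightarrow> nat \<Rightarrow> 'a \<Rightarrow> bool" where
  "multiplicity_free \<rho> n X \<longleftrightarrow> card (spec \<rho> X) = n"

definition prim_idem ::
  "('k::field \<Rightarrow> 'a::ring_1 \<Rightarrow> 'a) \<Rightarrow> ('a \<Rightarrow> 'k mat) \<Rightarrow> 'a \<Rightarrow> 'k \<Rightarrow> 'a" where
  "prim_idem scA \<rho> X \<theta> =
     poly_alg scA (\<Prod>\<mu>\<in>spec \<rho> X - {\<theta>}. Polynomial.smult (inverse (\<theta> - \<mu>)) [:- \<mu>, 1:]) X"

text \<open>
  Sequences indexed by \<open>0, \<dots>, d\<close> (or \<open>1, \<dots>, d\<close>) are functions on the natural numbers whose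
  values outside that range are irrelevant.
\<close>

definition leonard_system ::
  "('k::field \<Rightarrow> 'a::ring_1 \<Rightarrow> 'a) \<Rightarrow> ('a \<Rightarrow> 'k mat) \<Rightarrow> nat \<Rightarrow>
   'a \<Rightarrow> (nat \<Rightarrow> 'a) \<Rightarrow> 'a \<Rightarrow> (nat \<Rightarrow> 'a) \<Rightarrow> bool" where
  "leonard_system scA \<rho> d A E As Es \<longleftrightarrow>
     multiplicity_free \<rho> (d + 1) A \<and> multiplicity_free \<rho> (d + 1) As \<and>
     bij_betw E {0..d} (prim_idem scA \<rho> A ` spec \<rho> A) \<and>
     bij_betw Es {0..d} (prim_idem scA \<rho> As ` spec \<rho> As) \<and>
     (\<forall>i\<le>d. \<forall>j\<le>d.
        (\<bar>int i - int j\<bar> > 1 \<longrightarrow> E i * As * E j = 0) \<and>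
        (\<bar>int i - int j\<bar> = 1 \<longrightarrow> E i * As * E j \<noteq> 0)) \<and>
     (\<forall>i\<le>d. \<forall>j\<le>d.
        (\<bar>int i - int j\<bar> > 1 \<longrightarrow> Es i * A * Es j = 0) \<and>
        (\<bar>int i - int j\<bar> = 1 \<longrightarrow> Es i * A * Es j \<noteq> 0))"

definition tau_poly :: "(nat \<Rightarrow> 'k::field) \<Rightarrow> nat \<Rightarrow> 'k poly" where
  "tau_poly \<theta> i = (\<Prod>h<i. [:- \<theta> h, 1:])"

definition eta_poly :: "nat \<Rightarrow> (nat \<Rightarrow> 'k::field) \<Rightarrow> nat \<Rightarrow> 'k poly" where
  "eta_poly d \<theta> i = (\<Prod>h<i. [:- \<theta> (d - h), 1:])"

text \<open>
  The scalars \<open>vphi i\<close> and \<open>phi i\<close> form the first and the second split sequence, usually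
  written with the two variants of the Greek letter phi.
\<close>

definition parameter_array ::
  "('k::field \<Rightarrow> 'a::ring_1 \<Rightarrow> 'a) \<Rightarrow> ('a \<Rightarrow> 'k mat) \<Rightarrow> nat \<Rightarrow>
   'a \<Rightarrow> (nat \<Rightarrow> 'a) \<Rightarrow> 'a \<Rightarrow> (nat \<Rightarrow> 'a) \<Rightarrow>
   (nat \<Rightarrow> 'k) \<Rightarrow> (nat \<Rightarrow> 'k) \<Rightarrow> (nat \<Rightarrow> 'k) \<Rightarrow> (nat \<Rightarrow> 'k) \<Rightarrow> bool" where
  "parameter_array scA \<rho> d A E As Es \<theta> \<theta>s vphi phi \<longleftrightarrow>
     (\<forall>i\<le>d. \<theta> i \<in> spec \<rho> A \<and> E i = prim_idem scA \<rho> A (\<theta> i)) \<and>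
     (\<forall>i\<le>d. \<theta>s i \<in> spec \<rho> As \<and> Es i = prim_idem scA \<rho> As (\<theta>s i)) \<and>
     (\<forall>i\<in>{1..d}. vphi i = (\<theta>s 0 - \<theta>s i) *
        (tr \<rho> (poly_alg scA (tau_poly \<theta> i) A * Es 0) /
         tr \<rho> (poly_alg scA (tau_poly \<theta> (i - 1)) A * Es 0))) \<and>
     (\<forall>i\<in>{1..d}. phi i = (\<theta>s 0 - \<theta>s i) *
        (tr \<rho> (poly_alg scA (eta_poly d \<theta> i) A * Es 0) /
         tr \<rho> (poly_alg scA (eta_poly d \<theta> (i - 1)) A * Es 0)))"

definition antiautomorphism ::
  "('k::field \<Rightarrow> 'a::ring_1 \<Rightarrow> 'a) \<Rightarrow> ('a \<Rightarrow> 'a) \<Rightarrow> bool" where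
  "antiautomorphism scA dag \<longleftrightarrow>
     Vector_Spaces.linear scA scA dag \<and> bij dag \<and> (\<forall>X Y. dag (X * Y) = dag Y * dag X)"

definition bilinear_form ::
  "('k::field \<Rightarrow> 'v::ab_group_add \<Rightarrow> 'v) \<Rightarrow> ('v \<Rightarrow> 'v \<Rightarrow> 'k) \<Rightarrow> bool" where
  "bilinear_form scV bf \<longleftrightarrow>
     (\<forall>v. Vector_Spaces.linear scV (*) (\<lambda>u. bf u v)) \<and>
     (\<forall>u. Vector_Spaces.linear scV (*) (\<lambda>v. bf u v))"

end

theory Submission
  imports Defs
begin

text \<open>
  Each of the sums has the form \<open>\<Sum>r. X r * Z r\<close> and is applied to \<open>\<tau>\<^sup>*\<^sub>i(A\<^sup>*) \<xi>\<^sub>0\<close>.  The sequence \<open>X\<close> is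
  arbitrary in them: all that has to be shown is that \<open>Z r\<close> applied to \<open>\<tau>\<^sup>*\<^sub>i(A\<^sup>*) \<xi>\<^sub>0\<close> is zero for
  \<open>r \<noteq> i\<close>, and for \<open>r = i\<close> is a vector independent of \<open>i\<close> that the scalar in front normalises.
  There are two such biorthogonality relations.

  The first one (\<open>split_biorthogonal\<close>) is
  \<open>E\<^sup>*\<^sub>0 \<tau>\<^sub>r(A) \<tau>\<^sup>*\<^sub>i(A\<^sup>*) E\<^sub>0 = \<delta>\<^sub>r\<^sub>i p\<^sub>1\<dots>p\<^sub>r E\<^sup>*\<^sub>0 E\<^sub>0\<close>, where \<open>p\<^sub>1, \<dots>, p\<^sub>d\<close> is the first split sequence.
  By the three-term conditions a polynomial of degree \<open>k\<close> in one of the elements moves the index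
  of an idempotent of the other by at most \<open>k\<close>; so \<open>E\<^sup>*\<^sub>0 \<tau>\<^sub>r(A)\<close> meets only the \<open>E\<^sup>*\<^sub>j\<close> with \<open>j \<le> r\<close>,
  which \<open>\<tau>\<^sup>*\<^sub>i(A\<^sup>*)\<close> annihilates if \<open>r < i\<close>, and symmetrically on the other side if \<open>i < r\<close>.
  On the diagonal only leading coefficients count, and an exchange of \<open>\<tau>\<^sup>*\<^sub>r\<close> for the
  monic polynomial with roots \<open>\<theta>\<^sup>*\<^sub>1, \<dots>, \<theta>\<^sup>*\<^sub>r\<close> yields the trace that defines the split sequence.

  The second one (\<open>corner_biorthogonal\<close>) is
  \<open>E\<^sub>d \<eta>\<^sup>*\<^sub>d\<^sub>-\<^sub>r(A\<^sup>*) \<tau>\<^sup>*\<^sub>i(A\<^sup>*) E\<^sub>0 = \<delta>\<^sub>r\<^sub>i E\<^sub>d (A\<^sup>*)\<^sup>d E\<^sub>0\<close>, by comparing the degree with \<open>d\<close> and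
  the roots with the spectrum of \<open>A\<^sup>*\<close>.  The corner \<open>E\<^sub>d (A\<^sup>*)\<^sup>d E\<^sub>0\<close> is a nonzero multiple of
  every \<open>E\<^sub>d E\<^sup>*\<^sub>i E\<^sub>0\<close>, because the interpolation polynomials of \<open>A\<^sup>*\<close> are multiples of monic
  polynomials of degree \<open>d\<close> (\<open>corner_idem\<close>).  Its nonvanishing is the source of that
  of the traces and of the inner products between an eigenvector of \<open>A\<close> and one of \<open>A\<^sup>*\<close>.

  The scalars are then determined by rank one, \<open>E X E = tr(X E) E\<close>, and by the form, with
  respect to which every primitive idempotent is an orthogonal projection onto a line.  The
  product of the second split sequence is moved from \<open>E\<^sup>*\<^sub>0\<close>, where it is defined, to \<open>E\<^sup>*\<^sub>d\<close>, where it
  is needed, by \<open>trace_corner_exchange\<close>.  The passage from matrices to idempotents of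
  rank one is \<open>prim_idem_resolution\<close>.
\<close>

section \<open>Resolutions into idempotents of rank one\<close>

text \<open>
  The three-term condition that each of the two elements of a Leonard system satisfies with
  respect to the primitive idempotents of the other one.
\<close>

definition irreducible_tridiagonal :: "nat \<Rightarrow> (nat \<Rightarrow> 'a::ring_1) \<Rightarrow> 'a \<Rightarrow> bool" where
  "irreducible_tridiagonal d E B \<longleftrightarrow> (\<forall>i\<le>d. \<forall>j\<le>d.
     (\<bar>int i - int j\<bar> > 1 \<longrightarrow> E i * B * E j = 0) \<and>
     (\<bar>int i - int j\<bar> = 1 \<longrightarrow> E i * B * E j \<noteq> 0))"

text \<open>
  What a multiplicity-free element contributes to the argument, without matrices: its
  polynomials are diagonal in the idempotents, and each idempotent has rank one.  Rank one is
  used through two consequences.  Compressing by \<open>E i\<close> gives a multiple of \<open>E i\<close>, the factor being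
  a trace; and a product of nonzero factors that meet in \<open>E i\<close> is nonzero, since a matrix
  \<open>f g\<^sup>T\<close> of rank one separates it into the column \<open>X f\<close> and the row \<open>g\<^sup>T Y\<close>.
\<close>

locale rank_one_resolution = field_algebra scA
  for scA :: "'k::field \<Rightarrow> 'a::ring_1 \<Rightarrow> 'a" +
  fixes t :: "'a \<Rightarrow> 'k" and d :: nat and A :: 'a and E :: "nat \<Rightarrow> 'a" and \<theta> :: "nat \<Rightarrow> 'k"
  assumes inj_eigenvalues: "inj_on \<theta> {..d}"
    and idem_nonzero: "i \<le> d \<Longrightarrow> E i \<noteq> 0"
    and orthogonal: "i \<le> d \<Longrightarrow> j \<le> d \<Longrightarrow> E i * E j = (if i = j then E i else 0)"
    and poly_resolution: "poly_alg scA q A = (\<Sum>i\<le>d. scA (poly q (\<theta> i)) (E i))"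
    and compress: "i \<le> d \<Longrightarrow> E i * X * E i = scA (t (X * E i)) (E i)"
    and rank_one_nonzero: "i \<le> d \<Longrightarrow> X * E i \<noteq> 0 \<Longrightarrow> E i * Y \<noteq> 0 \<Longrightarrow> X * E i * Y \<noteq> 0"
    and trace_scale: "t (scA c X) = c * t X"
    and trace_comm: "t (X * Y) = t (Y * X)"
begin

lemmas scale_mult = scale_mult_left scale_mult_right

lemma poly_alg_one: "poly_alg scA 1 A = 1"
  by (simp add: poly_alg_def)

lemma sum_idem: "(\<Sum>i\<le>d. E i) = 1"
  using poly_resolution[of 1] poly_alg_one by simp

lemma insert_resolution: "X * Y = (\<Sum>i\<le>d. X * E i * Y)"
proof -
  have "X * Y = X * (\<Sum>i\<le>d. E i) * Y" by (simp add: sum_idem)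
  then show ?thesis by (simp add: sum_distrib_left sum_distrib_right)
qed

lemma poly_idem:
  assumes "i \<le> d"
  shows "poly_alg scA q A * E i = scA (poly q (\<theta> i)) (E i)"
proof -
  have "poly_alg scA q A * E i = (\<Sum>j\<le>d. if j = i then scA (poly q (\<theta> i)) (E i) else 0)"
    unfolding poly_resolution sum_distrib_right scale_mult
    using assms by (intro sum.cong) (auto simp: orthogonal)
  then show ?thesis using assms by simp
qed

lemma idem_poly:
  assumes "i \<le> d"
  shows "E i * poly_alg scA q A = scA (poly q (\<theta> i)) (E i)"
proof -
  have "E i * poly_alg scA q A = (\<Sum>j\<le>d. if j = i then scA (poly q (\<theta> i)) (E i) else 0)"
    unfolding poly_resolution sum_distrib_left scale_mult
    using assms by (intro sum.cong) (auto simp: orthogonal)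
  then show ?thesis using assms by simp
qed

lemma poly_alg_mult: "poly_alg scA (p * q) A = poly_alg scA p A * poly_alg scA q A"
proof -
  have "poly_alg scA p A * poly_alg scA q A = (\<Sum>i\<le>d. scA (poly q (\<theta> i)) (poly_alg scA p A * E i))"
    by (simp add: poly_resolution[of q] sum_distrib_left scale_mult)
  also have "\<dots> = (\<Sum>i\<le>d. scA (poly (p * q) (\<theta> i)) (E i))"
    by (intro sum.cong) (simp_all add: poly_idem mult.commute)
  finally show ?thesis by (simp add: poly_resolution)
qed

lemma poly_alg_eq_idem:
  assumes "i \<le> d" and "\<And>j. j \<le> d \<Longrightarrow> j \<noteq> i \<Longrightarrow> poly q (\<theta> j) = 0"
  shows "poly_alg scA q A = scA (poly q (\<theta> i)) (E i)"
proof -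
  have "poly_alg scA q A = (\<Sum>j\<le>d. if j = i then scA (poly q (\<theta> i)) (E i) else 0)"
    unfolding poly_resolution using assms by (intro sum.cong) auto
  then show ?thesis using assms(1) by simp
qed

lemma trace_idem: "i \<le> d \<Longrightarrow> t (E i) = 1"
  using compress[of i 1] idem_nonzero[of i] orthogonal[of i i]
  by (metis mult.left_neutral mult.right_neutral scale_cancel_right scale_one)

lemma band_zero:
  assumes B: "irreducible_tridiagonal d E B" and "i \<le> d" "j \<le> d" "int k < \<bar>int i - int j\<bar>"
  shows "E i * B ^ k * E j = 0"
  using assms(2,4)
proof (induction k arbitrary: i)
  case 0
  then have "i \<noteq> j" by auto
  then show ?case using 0 assms(3) by (simp add: orthogonal)
next
  case (Suc k)
  have "E i * B ^ Suc k * E j = (E i * B) * (B ^ k * E j)"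
    by (simp add: mult.assoc)
  also have "\<dots> = (\<Sum>l\<le>d. E i * B * E l * (B ^ k * E j))"
    by (rule insert_resolution)
  also have "\<dots> = 0"
  proof (rule sum.neutral, safe)
    fix l assume l: "l \<le> d"
    show "E i * B * E l * (B ^ k * E j) = 0"
    proof (cases "\<bar>int i - int l\<bar> > 1")
      case True
      then have "E i * B * E l = 0"
        using B Suc.prems l unfolding irreducible_tridiagonal_def by blast
      then show ?thesis by simp
    next
      case False
      then have "int k < \<bar>int l - int j\<bar>" using Suc.prems by linarith
      then have "E l * B ^ k * E j = 0" using Suc.IH l by blast
      then have "E i * B * (E l * B ^ k * E j) = 0" by simp
      then show ?thesis by (simp only: mult.assoc)
    qed
  qed
  finally show ?case .
qed

text \<open>
  Only one path of length \<open>k\<close> leads from \<open>j\<close> to \<open>j + k\<close>, so the compression is a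
  single product of steps \<open>E (l + 1) * B * E l\<close>, and rank one keeps such a chain nonzero.
\<close>

lemma band_edge_nonzero:
  assumes B: "irreducible_tridiagonal d E B" and "j + k \<le> d"
  shows "E (j + k) * B ^ k * E j \<noteq> 0"
  using assms(2)
proof (induction k)
  case 0
  then show ?case by (simp add: orthogonal idem_nonzero)
next
  case (Suc k)
  let ?i = "j + Suc k"
  have "E ?i * B ^ Suc k * E j = (E ?i * B) * (B ^ k * E j)"
    by (simp add: mult.assoc)
  also have "\<dots> = (\<Sum>l\<le>d. E ?i * B * E l * (B ^ k * E j))"
    by (rule insert_resolution)
  also have "\<dots> = (\<Sum>l\<le>d. if l = j + k then E ?i * B * E l * (B ^ k * E j) else 0)"
  proof (rule sum.cong, safe)
    fix l assume l: "l \<le> d"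
    show "E ?i * B * E l * (B ^ k * E j) = (if l = j + k then E ?i * B * E l * (B ^ k * E j) else 0)"
    proof (cases "l < j + k")
      case True
      then have "\<bar>int ?i - int l\<bar> > 1" by simp
      then have "E ?i * B * E l = 0"
        using B Suc.prems l unfolding irreducible_tridiagonal_def by blast
      then show ?thesis using True by simp
    next
      case F: False
      show ?thesis
      proof (cases "l = j + k")
        case False
        then have "int k < \<bar>int l - int j\<bar>" using F by linarith
        then have "E l * B ^ k * E j = 0" using band_zero[OF B] l Suc.prems by simp
        then have "E ?i * B * (E l * B ^ k * E j) = 0" by simp
        then show ?thesis using False by (simp add: mult.assoc)
      qed simp
    qed
  qed
  also have "\<dots> = E ?i * B * E (j + k) * (B ^ k * E j)"
    using Suc.prems by simp
  also have "\<dots> \<noteq> 0"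
  proof (rule rank_one_nonzero)
    show "E ?i * B * E (j + k) \<noteq> 0"
      using B Suc.prems unfolding irreducible_tridiagonal_def by simp
    show "E (j + k) * (B ^ k * E j) \<noteq> 0"
      using Suc by (simp add: mult.assoc)
  qed (use Suc.prems in simp)
  finally show ?case .
qed

text \<open>
  A polynomial whose degree does not exceed the distance \<open>m\<close> of the two indices is seen only
  through its coefficient at \<open>m\<close>.  Hence it can be exchanged for any other one with the same
  coefficient, which is how all the scalars below are computed.
\<close>

lemma band_poly:
  assumes B: "irreducible_tridiagonal d E B" and ij: "i \<le> d" "j \<le> d"
    and m: "int m = \<bar>int i - int j\<bar>" and deg: "degree q \<le> m"
  shows "E i * poly_alg scA q B * E j = scA (coeff q m) (E i * B ^ m * E j)"
proof -
  have "E i * poly_alg scA q B * E j = (\<Sum>k\<le>degree q. scA (coeff q k) (E i * B ^ k * E j))"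
    by (simp add: poly_alg_def sum_distrib_left sum_distrib_right scale_mult)
  also have "\<dots> = (\<Sum>k\<le>m. scA (coeff q k) (E i * B ^ k * E j))"
    using deg by (intro sum.mono_neutral_left) (auto simp: coeff_eq_0)
  also have "\<dots> = (\<Sum>k\<le>m. if k = m then scA (coeff q m) (E i * B ^ m * E j) else 0)"
    using band_zero[OF B ij] m by (intro sum.cong) auto
  finally show ?thesis by simp
qed

end

section \<open>Leonard systems and their symmetries\<close>

text \<open>
  Reversing the order of the idempotents, and exchanging the two elements, give a Leonard
  system again.  These symmetries transfer each statement below to the second split sequence
  and to the opposite corners.
\<close>

lemma irreducible_tridiagonal_reverse:
  assumes "irreducible_tridiagonal d E B"
  shows "irreducible_tridiagonal d (\<lambda>i. E (d - i)) B"
  unfolding irreducible_tridiagonal_def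
proof (intro allI impI)
  fix i j assume ij: "i \<le> d" "j \<le> d"
  then have "\<bar>int (d - i) - int (d - j)\<bar> = \<bar>int i - int j\<bar>" by linarith
  then show "(1 < \<bar>int i - int j\<bar> \<longrightarrow> E (d - i) * B * E (d - j) = 0) \<and>
       (\<bar>int i - int j\<bar> = 1 \<longrightarrow> E (d - i) * B * E (d - j) \<noteq> 0)"
    using assms unfolding irreducible_tridiagonal_def by (metis diff_le_self)
qed

lemma rank_one_resolution_reverse:
  assumes "rank_one_resolution scA t d A E \<theta>"
  shows "rank_one_resolution scA t d A (\<lambda>i. E (d - i)) (\<lambda>i. \<theta> (d - i))"
proof -
  interpret rank_one_resolution scA t d A E \<theta> by fact
  have flip: "(\<Sum>i\<le>d. f (d - i)) = (\<Sum>i\<le>d. f i)" for f :: "nat \<Rightarrow> 'b"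
    by (rule sum.reindex_bij_witness[where i = "\<lambda>i. d - i" and j = "\<lambda>i. d - i"]) auto
  show ?thesis
  proof unfold_locales
    show "inj_on (\<lambda>i. \<theta> (d - i)) {..d}"
    proof (rule inj_onI)
      fix i j assume "i \<in> {..d}" "j \<in> {..d}" "\<theta> (d - i) = \<theta> (d - j)"
      moreover from this have "d - i = d - j"
        using inj_onD[OF inj_eigenvalues] by simp
      ultimately show "i = j" by simp
    qed
    show "poly_alg scA q A = (\<Sum>i\<le>d. scA (poly q (\<theta> (d - i))) (E (d - i)))" for q
      using flip[of "\<lambda>i. scA (poly q (\<theta> i)) (E i)"] by (simp add: poly_resolution)
    show "i \<le> d \<Longrightarrow> j \<le> d \<Longrightarrow> E (d - i) * E (d - j) = (if i = j then E (d - i) else 0)" for i j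
      by (auto simp: orthogonal)
  qed (simp_all add: idem_nonzero compress rank_one_nonzero trace_scale trace_comm)
qed

locale leonard_pair =
  L: rank_one_resolution scA t d A E \<theta> + S: rank_one_resolution scA t d As Es \<theta>s
  for scA :: "'k::field \<Rightarrow> 'a::ring_1 \<Rightarrow> 'a" and t :: "'a \<Rightarrow> 'k" and d :: nat
    and A :: 'a and E :: "nat \<Rightarrow> 'a" and \<theta> :: "nat \<Rightarrow> 'k"
    and As :: 'a and Es :: "nat \<Rightarrow> 'a" and \<theta>s :: "nat \<Rightarrow> 'k" +
  assumes tridiagonal: "irreducible_tridiagonal d E As"
    and tridiagonal_star: "irreducible_tridiagonal d Es A"

lemma leonard_pair_swap:
  "leonard_pair scA t d A E \<theta> As Es \<theta>s \<Longrightarrow> leonard_pair scA t d As Es \<theta>s A E \<theta>"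
  unfolding leonard_pair_def leonard_pair_axioms_def by blast

lemma leonard_pair_reverse:
  "leonard_pair scA t d A E \<theta> As Es \<theta>s \<Longrightarrow>
   leonard_pair scA t d A (\<lambda>i. E (d - i)) (\<lambda>i. \<theta> (d - i)) As Es \<theta>s"
  unfolding leonard_pair_def leonard_pair_axioms_def
  using rank_one_resolution_reverse irreducible_tridiagonal_reverse by blast

section \<open>Products of linear factors\<close>

lemma monic_prod_linear: "lead_coeff (\<Prod>h\<in>H. [:- f h, 1:]) = (1::'k::field)"
  by (simp add: lead_coeff_prod)

lemma degree_prod_linear: "degree (\<Prod>h\<in>H. [:- (f h :: 'k::field), 1:]) = card H"
  by (subst degree_prod_eq_sum_degree) simp_all

lemma poly_prod_linear: "poly (\<Prod>h\<in>H. [:- f h, 1:]) x = (\<Prod>h\<in>H. x - f h :: 'k::field)"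
  by (simp add: poly_prod algebra_simps)

section \<open>The corner, the split sequences and biorthogonality\<close>

context leonard_pair
begin

abbreviation "pA q \<equiv> poly_alg scA q A"
abbreviation "pS q \<equiv> poly_alg scA q As"

lemma corner_monic:
  assumes "degree q = d" "lead_coeff q = 1"
  shows "E d * pS q * E 0 = E d * As ^ d * E 0"
  using L.band_poly[OF tridiagonal, of d 0 d q] assms by simp

text \<open>
  The product of all \<open>x - \<theta>s h\<close> with \<open>h \<noteq> i\<close> is monic of degree \<open>d\<close>, and at \<open>As\<close> it is a
  multiple of \<open>Es i\<close>.  As all monic polynomials of degree \<open>d\<close> agree between \<open>E d\<close> and \<open>E 0\<close>, the
  right-hand side does not depend on \<open>i\<close>.
\<close>

lemma corner_idem:
  assumes i: "i \<le> d"
  shows "E d * As ^ d * E 0 = scA (\<Prod>h\<in>{..d}-{i}. \<theta>s i - \<theta>s h) (E d * Es i * E 0)"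
proof -
  let ?q = "\<Prod>h\<in>{..d}-{i}. [:- \<theta>s h, 1:]"
  have q: "pS ?q = scA (poly ?q (\<theta>s i)) (Es i)"
    using i by (intro S.poly_alg_eq_idem) (auto simp: poly_prod_linear)
  have "E d * As ^ d * E 0 = E d * pS ?q * E 0"
  proof (rule corner_monic[symmetric])
    show "degree ?q = d" using i by (simp add: degree_prod_linear)
    show "lead_coeff ?q = 1" by (rule monic_prod_linear)
  qed
  then show ?thesis
    by (simp add: q S.scale_mult poly_prod_linear)
qed

text \<open>
  Both products are factors of the corner, which is nonzero.
\<close>

lemma idem_products_nonzero:
  assumes i: "i \<le> d"
  shows "Es i * E 0 \<noteq> 0" "E d * Es i \<noteq> 0"
proof -
  have "E d * As ^ d * E 0 \<noteq> 0"
    using L.band_edge_nonzero[OF tridiagonal, of 0 d] by simp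
  then have "E d * Es i * E 0 \<noteq> 0"
    using corner_idem[OF i] by auto
  then show "Es i * E 0 \<noteq> 0" "E d * Es i \<noteq> 0"
    by (metis mult.assoc mult_zero_right, metis mult_zero_left)
qed

lemma idem_products_nonzero':
  assumes i: "i \<le> d"
  shows "Es i * E d \<noteq> 0" "E 0 * Es i \<noteq> 0"
  using leonard_pair.idem_products_nonzero[OF leonard_pair_reverse[OF leonard_pair_axioms] i] by simp_all

text \<open>
  To the right of \<open>Es 0\<close>, a polynomial of degree at most \<open>r\<close> in \<open>A\<close> reaches only the
  idempotents \<open>Es j\<close> with \<open>j \<le> r\<close>, and \<open>p\<close> removes all of these but \<open>Es 0\<close>.
\<close>

lemma left_collapse:
  assumes deg: "degree q \<le> r" and p: "\<And>j. 1 \<le> j \<Longrightarrow> j \<le> r \<Longrightarrow> j \<le> d \<Longrightarrow> poly p (\<theta>s j) = 0"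
  shows "Es 0 * pA q * pS p = scA (poly p (\<theta>s 0) * t (pA q * Es 0)) (Es 0)"
proof -
  have "Es 0 * pA q * pS p = (\<Sum>j\<le>d. Es 0 * pA q * Es j * pS p)"
    by (rule S.insert_resolution)
  also have "\<dots> = (\<Sum>j\<le>d. scA (poly p (\<theta>s j)) (Es 0 * pA q * Es j))"
    by (intro sum.cong) (simp_all add: mult.assoc S.idem_poly S.scale_mult)
  also have "\<dots> = (\<Sum>j\<le>d. if j = 0 then scA (poly p (\<theta>s 0)) (Es 0 * pA q * Es 0) else 0)"
  proof (rule sum.cong, safe)
    fix j assume j: "j \<le> d"
    show "scA (poly p (\<theta>s j)) (Es 0 * pA q * Es j) =
        (if j = 0 then scA (poly p (\<theta>s 0)) (Es 0 * pA q * Es 0) else 0)"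
    proof (cases "j \<le> r")
      case True then show ?thesis using p j by (cases "j = 0") auto
    next
      case False
      then have "Es 0 * pA q * Es j = 0"
        using S.band_poly[OF tridiagonal_star, of 0 j j q] deg j by (simp add: coeff_eq_0)
      then show ?thesis using False by simp
    qed
  qed
  finally show ?thesis by (simp add: S.compress)
qed

text \<open>
  To the left of \<open>E 0\<close>, a polynomial of degree at most \<open>r\<close> in \<open>As\<close> reaches only the
  idempotents \<open>E j\<close> with \<open>j \<le> r\<close>, and \<open>tau_poly \<theta> r\<close> removes all of these but \<open>E r\<close>.
\<close>

lemma right_collapse:
  assumes r: "r \<le> d" and deg: "degree p \<le> r"
  shows "pA (tau_poly \<theta> r) * pS p * E 0 =
    scA (poly (tau_poly \<theta> r) (\<theta> r) * coeff p r) (E r * As ^ r * E 0)"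
proof -
  have "pA (tau_poly \<theta> r) * pS p * E 0 = pA (tau_poly \<theta> r) * (pS p * E 0)"
    by (simp add: mult.assoc)
  also have "\<dots> = (\<Sum>j\<le>d. pA (tau_poly \<theta> r) * E j * (pS p * E 0))"
    by (rule L.insert_resolution)
  also have "\<dots> = (\<Sum>j\<le>d. scA (poly (tau_poly \<theta> r) (\<theta> j)) (E j * pS p * E 0))"
    by (intro sum.cong) (simp_all add: L.poly_idem L.scale_mult mult.assoc)
  also have "\<dots> = (\<Sum>j\<le>d. if j = r then scA (poly (tau_poly \<theta> r) (\<theta> r)) (E r * pS p * E 0) else 0)"
  proof (rule sum.cong, safe)
    fix j assume j: "j \<le> d"
    show "scA (poly (tau_poly \<theta> r) (\<theta> j)) (E j * pS p * E 0) =
        (if j = r then scA (poly (tau_poly \<theta> r) (\<theta> r)) (E r * pS p * E 0) else 0)"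
    proof (cases j r rule: linorder_cases)
      case less
      then show ?thesis by (auto simp: tau_poly_def poly_prod_linear)
    next
      case greater
      then have "E j * pS p * E 0 = 0"
        using L.band_poly[OF tridiagonal, of j 0 j p] deg j by (simp add: coeff_eq_0)
      then show ?thesis using greater by simp
    qed simp
  qed
  also have "\<dots> = scA (poly (tau_poly \<theta> r) (\<theta> r)) (E r * pS p * E 0)" using r by simp
  finally show ?thesis
    using L.band_poly[OF tridiagonal, of r 0 r p] r deg by simp
qed

text \<open>
  The first split sequence arises here.  Off the diagonal one of the two collapses gives zero.
  On the diagonal only the leading coefficient of \<open>tau_poly \<theta>s r\<close> counts, so that its roots
  \<open>\<theta>s 0, \<dots>, \<theta>s (r - 1)\<close> may be replaced with \<open>\<theta>s 1, \<dots>, \<theta>s r\<close>; then the left collapse applies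
  and leaves the trace.
\<close>

lemma split_biorthogonal:
  assumes r: "r \<le> d" and i: "i \<le> d"
  shows "Es 0 * pA (tau_poly \<theta> r) * pS (tau_poly \<theta>s i) * E 0 =
    (if r = i then scA ((\<Prod>k=1..r. \<theta>s 0 - \<theta>s k) * t (pA (tau_poly \<theta> r) * Es 0)) (Es 0 * E 0) else 0)"
proof (cases r i rule: linorder_cases)
  case less
  have "Es 0 * pA (tau_poly \<theta> r) * pS (tau_poly \<theta>s i) = 0"
    using less by (subst left_collapse[of _ r]) (auto simp: tau_poly_def degree_prod_linear poly_prod_linear)
  then show ?thesis using less by simp
next
  case greater
  have "pA (tau_poly \<theta> r) * pS (tau_poly \<theta>s i) * E 0 = 0"
    using greater r by (subst right_collapse)
      (auto simp: tau_poly_def degree_prod_linear coeff_eq_0)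
  then show ?thesis using greater by (simp add: mult.assoc)
next
  case equal
  let ?p = "\<Prod>k\<in>{1..r}. [:- \<theta>s k, 1:]"
  have dp: "degree ?p = r" "degree (tau_poly \<theta>s r) = r" "degree (tau_poly \<theta> r) = r"
    by (simp_all add: degree_prod_linear tau_poly_def)
  have cp: "coeff ?p r = 1" "coeff (tau_poly \<theta>s r) r = 1"
    using monic_prod_linear[of \<theta>s "{1..r}"] monic_prod_linear[of \<theta>s "{..<r}"] dp
    unfolding tau_poly_def by metis+
  have "Es 0 * pA (tau_poly \<theta> r) * pS (tau_poly \<theta>s r) * E 0 =
      Es 0 * (pA (tau_poly \<theta> r) * pS (tau_poly \<theta>s r) * E 0)" by (simp add: mult.assoc)
  also have "pA (tau_poly \<theta> r) * pS (tau_poly \<theta>s r) * E 0 = pA (tau_poly \<theta> r) * pS ?p * E 0"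
    using r dp cp by (simp add: right_collapse)
  also have "Es 0 * \<dots> = (Es 0 * pA (tau_poly \<theta> r) * pS ?p) * E 0" by (simp add: mult.assoc)
  also have "Es 0 * pA (tau_poly \<theta> r) * pS ?p =
      scA (poly ?p (\<theta>s 0) * t (pA (tau_poly \<theta> r) * Es 0)) (Es 0)"
    by (rule left_collapse[of _ r]) (auto simp: dp poly_prod_linear)
  finally show ?thesis using equal by (simp add: poly_prod_linear S.scale_mult)
qed

text \<open>
  Evaluated without the exchange of roots, the diagonal value of the preceding lemma is a
  nonzero multiple of the chain \<open>Es 0 * A ^ r * Es r * E 0\<close>, which is nonzero by rank one.
\<close>

lemma split_trace_nonzero:
  assumes r: "r \<le> d"
  shows "t (pA (tau_poly \<theta> r) * Es 0) \<noteq> 0"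
proof
  assume "t (pA (tau_poly \<theta> r) * Es 0) = 0"
  then have z: "Es 0 * pA (tau_poly \<theta> r) * pS (tau_poly \<theta>s r) * E 0 = 0"
    using split_biorthogonal[OF r r] by simp
  have dp: "degree (tau_poly \<theta> r) = r" "coeff (tau_poly \<theta> r) r = 1"
    using monic_prod_linear[of \<theta> "{..<r}"] degree_prod_linear[of \<theta> "{..<r}"]
    unfolding tau_poly_def by simp_all
  have "Es 0 * pA (tau_poly \<theta> r) * pS (tau_poly \<theta>s r) =
      (\<Sum>j\<le>d. Es 0 * pA (tau_poly \<theta> r) * Es j * pS (tau_poly \<theta>s r))"
    by (rule S.insert_resolution)
  also have "\<dots> = (\<Sum>j\<le>d. scA (poly (tau_poly \<theta>s r) (\<theta>s j)) (Es 0 * pA (tau_poly \<theta> r) * Es j))"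
    by (intro sum.cong) (simp_all add: mult.assoc S.idem_poly S.scale_mult)
  also have "\<dots> = (\<Sum>j\<le>d. if j = r then
      scA (poly (tau_poly \<theta>s r) (\<theta>s r)) (Es 0 * pA (tau_poly \<theta> r) * Es r) else 0)"
  proof (rule sum.cong, safe)
    fix j assume j: "j \<le> d"
    show "scA (poly (tau_poly \<theta>s r) (\<theta>s j)) (Es 0 * pA (tau_poly \<theta> r) * Es j) =
        (if j = r then scA (poly (tau_poly \<theta>s r) (\<theta>s r)) (Es 0 * pA (tau_poly \<theta> r) * Es r) else 0)"
    proof (cases j r rule: linorder_cases)
      case less
      then show ?thesis by (auto simp: tau_poly_def poly_prod_linear)
    next
      case greater
      then have "Es 0 * pA (tau_poly \<theta> r) * Es j = 0"
        using S.band_poly[OF tridiagonal_star, of 0 j j] dp j by (simp add: coeff_eq_0)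
      then show ?thesis using greater by simp
    qed simp
  qed
  also have "\<dots> = scA (poly (tau_poly \<theta>s r) (\<theta>s r)) (Es 0 * A ^ r * Es r)"
    using r S.band_poly[OF tridiagonal_star, of 0 r r "tau_poly \<theta> r"] dp by simp
  finally have eq: "Es 0 * pA (tau_poly \<theta> r) * pS (tau_poly \<theta>s r) * E 0 =
      scA (poly (tau_poly \<theta>s r) (\<theta>s r)) (Es 0 * A ^ r * Es r * E 0)"
    by (simp add: S.scale_mult)
  have "poly (tau_poly \<theta>s r) (\<theta>s r) \<noteq> 0"
    using S.inj_eigenvalues r by (fastforce simp: tau_poly_def poly_prod_linear inj_on_def)
  moreover have "Es 0 * A ^ r * Es r * E 0 \<noteq> 0"
  proof (rule S.rank_one_nonzero[OF r _ idem_products_nonzero(1)[OF r]])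
    interpret R: rank_one_resolution scA t d As "\<lambda>i. Es (d - i)" "\<lambda>i. \<theta>s (d - i)"
      by (rule rank_one_resolution_reverse) unfold_locales
    show "Es 0 * A ^ r * Es r \<noteq> 0"
      using R.band_edge_nonzero[OF irreducible_tridiagonal_reverse[OF tridiagonal_star], of "d - r" r] r
      by simp
  qed
  ultimately show False using z eq by auto
qed

text \<open>
  The quotients of traces telescope, because no denominator vanishes; the first trace is
  that of \<open>Es 0\<close>, which is 1.
\<close>

lemma split_product:
  assumes r: "r \<le> d"
    and vphi: "\<And>i. i \<in> {1..d} \<Longrightarrow> vphi i = (\<theta>s 0 - \<theta>s i) *
        (t (pA (tau_poly \<theta> i) * Es 0) / t (pA (tau_poly \<theta> (i - 1)) * Es 0))"
  shows "(\<Prod>k=1..r. vphi k) = (\<Prod>k=1..r. \<theta>s 0 - \<theta>s k) * t (pA (tau_poly \<theta> r) * Es 0)"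
  using r
proof (induction r)
  case 0
  then show ?case by (simp add: tau_poly_def L.poly_alg_one S.trace_idem)
next
  case (Suc r)
  then have "(\<Prod>k=1..Suc r. vphi k) =
      ((\<Prod>k=1..r. \<theta>s 0 - \<theta>s k) * t (pA (tau_poly \<theta> r) * Es 0)) * vphi (Suc r)"
    by simp
  then show ?case using split_trace_nonzero[of r] vphi[of "Suc r"] Suc.prems
    by simp
qed

lemma split_product_nonzero:
  assumes r: "r \<le> d"
  shows "(\<Prod>k=1..r. \<theta>s 0 - \<theta>s k) * t (pA (tau_poly \<theta> r) * Es 0) \<noteq> 0"
proof -
  have "\<theta>s 0 - \<theta>s k \<noteq> 0" if "k \<in> {1..r}" for k
    using inj_onD[OF S.inj_eigenvalues, of 0 k] that r by auto
  then show ?thesis using split_trace_nonzero[OF r] by simp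
qed

text \<open>
  The two polynomials have the product degree \<open>d - r + i\<close>.  For \<open>i < r\<close> this is too small to
  connect \<open>E 0\<close> with \<open>E d\<close>; for \<open>r < i\<close> the product vanishes at every eigenvalue of \<open>As\<close>; for
  \<open>r = i\<close> it is monic of degree \<open>d\<close>.
\<close>

lemma corner_biorthogonal:
  assumes r: "r \<le> d" and i: "i \<le> d"
  shows "E d * pS (eta_poly d \<theta>s (d - r)) * pS (tau_poly \<theta>s i) * E 0 =
    (if r = i then E d * As ^ d * E 0 else 0)"
proof -
  let ?q = "eta_poly d \<theta>s (d - r) * tau_poly \<theta>s i"
  have e: "lead_coeff (eta_poly d \<theta>s (d - r)) = 1" "degree (eta_poly d \<theta>s (d - r)) = d - r"
    using monic_prod_linear[of "\<lambda>h. \<theta>s (d - h)" "{..<d - r}"]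
     degree_prod_linear[of "\<lambda>h. \<theta>s (d - h)" "{..<d - r}"] unfolding eta_poly_def by simp_all
  have s: "lead_coeff (tau_poly \<theta>s i) = 1" "degree (tau_poly \<theta>s i) = i"
    using monic_prod_linear[of \<theta>s "{..<i}"]
     degree_prod_linear[of \<theta>s "{..<i}"] unfolding tau_poly_def by simp_all
  have dq: "degree ?q = d - r + i"
    using e s by (subst degree_mult_eq) auto
  have lq: "lead_coeff ?q = 1" using e s by (simp only: lead_coeff_mult) simp
  have m: "E d * pS (eta_poly d \<theta>s (d - r)) * pS (tau_poly \<theta>s i) * E 0 = E d * pS ?q * E 0"
    by (simp add: S.poly_alg_mult mult.assoc)
  show ?thesis
  proof (cases r i rule: linorder_cases)
    case less
    have "poly ?q (\<theta>s j) = 0" if "j \<le> d" for j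
    proof (cases "j < i")
      case True then show ?thesis by (auto simp: tau_poly_def poly_prod_linear)
    next
      case False
      then have "d - j < d - r" "\<theta>s j = \<theta>s (d - (d - j))" using less that r by auto
      then show ?thesis unfolding eta_poly_def poly_mult poly_prod_linear by auto
    qed
    then have "pS ?q = 0" unfolding S.poly_resolution by (intro sum.neutral) simp
    then show ?thesis using m less by simp
  next
    case greater
    then show ?thesis
      using m dq r L.band_poly[OF tridiagonal, of d 0 d ?q] by (simp add: coeff_eq_0)
  next
    case equal
    then show ?thesis using m dq lq r corner_monic[of ?q] by simp
  qed
qed

lemma last_tau: "pA (tau_poly \<theta> d) = scA (poly (tau_poly \<theta> d) (\<theta> d)) (E d)"
  by (rule L.poly_alg_eq_idem) (auto simp: tau_poly_def poly_prod_linear)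

lemma corner_star_first:
  "E d * As ^ d * E 0 = scA (\<Prod>k=1..d. \<theta>s 0 - \<theta>s k) (E d * Es 0 * E 0)"
proof -
  have "{..d} - {0} = {1..d}" by auto
  then show ?thesis using corner_idem[of 0] by simp
qed

lemma corner_star_last:
  "E d * As ^ d * E 0 = scA (poly (tau_poly \<theta>s d) (\<theta>s d)) (E d * Es d * E 0)"
proof -
  have "{..d} - {d} = {..<d}" by auto
  then show ?thesis using corner_idem[of d] by (simp add: tau_poly_def poly_prod_linear)
qed

lemma corner_first_last:
  "scA (poly (tau_poly \<theta>s d) (\<theta>s d)) (E d * Es d * E 0) = scA (\<Prod>k=1..d. \<theta>s 0 - \<theta>s k) (E d * Es 0 * E 0)"
  using corner_star_first corner_star_last by simp

lemma eigenvalue_product_flip: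
  "(\<Prod>k=1..d. \<theta> 0 - \<theta> k) = poly (eta_poly d \<theta> d) (\<theta> 0)"
  unfolding eta_poly_def poly_prod_linear
  by (rule prod.reindex_bij_witness[where i = "\<lambda>h. d - h" and j = "\<lambda>h. d - h"]) auto

text \<open>
  Links the two corners \<open>(0, 0)\<close> and \<open>(d, d)\<close>: the factor \<open>E d * Es d * E 0 * Es 0\<close> can be
  changed at its left part into \<open>E d * Es 0 * E 0 * Es 0\<close>, or at its right part into
  \<open>E d * Es d * E d * Es 0\<close>, and both are multiples of \<open>E d * Es 0 \<noteq> 0\<close>.  It turns the second split
  sequence, defined by means of \<open>Es 0\<close>, into a statement on \<open>Es d\<close>.
\<close>

lemma trace_corner_exchange:
  "poly (tau_poly \<theta> d) (\<theta> d) * poly (tau_poly \<theta>s d) (\<theta>s d) * t (Es d * E d) =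
   (\<Prod>k=1..d. \<theta>s 0 - \<theta>s k) * (\<Prod>k=1..d. \<theta> 0 - \<theta> k) * t (E 0 * Es 0)"
proof -
  interpret W: leonard_pair scA t d As Es \<theta>s A E \<theta>
    by (rule leonard_pair_swap) (rule leonard_pair_axioms)
  let ?a = "poly (tau_poly \<theta> d) (\<theta> d)" and ?as = "poly (tau_poly \<theta>s d) (\<theta>s d)"
  let ?b = "\<Prod>k=1..d. \<theta> 0 - \<theta> k" and ?bs = "\<Prod>k=1..d. \<theta>s 0 - \<theta>s k"
  have c1: "E d * Es d * E d = scA (t (Es d * E d)) (E d)" by (rule L.compress) simp
  have c2: "Es 0 * E 0 * Es 0 = scA (t (E 0 * Es 0)) (Es 0)" by (rule S.compress) simp
  have "scA (?a * ?as * t (Es d * E d)) (E d * Es 0) = scA (?a * ?as) (E d * Es d * E d * Es 0)"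
    by (simp add: c1 L.scale_mult)
  also have "\<dots> = scA ?as (E d * scA ?a (Es d * E d * Es 0))"
    by (simp add: L.scale_mult mult.assoc mult.commute)
  also have "\<dots> = scA ?as (E d * scA ?b (Es d * E 0 * Es 0))"
    by (simp only: W.corner_first_last)
  also have "\<dots> = scA ?b (scA ?as (E d * Es d * E 0) * Es 0)"
    by (simp add: L.scale_mult mult.assoc mult.commute)
  also have "\<dots> = scA ?b (scA ?bs (E d * Es 0 * E 0) * Es 0)"
    by (simp only: corner_first_last)
  also have "\<dots> = scA (?bs * ?b) (E d * (Es 0 * E 0 * Es 0))"
    by (simp add: L.scale_mult mult.assoc mult.commute)
  also have "\<dots> = scA (?bs * ?b * t (E 0 * Es 0)) (E d * Es 0)"
    by (simp add: c2 L.scale_mult)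
  finally show ?thesis using idem_products_nonzero(2)[of 0] by simp
qed

end

section \<open>Primitive idempotents of a multiplicity-free matrix\<close>

locale matrix_algebra = field_algebra scA
  for scA :: "'k::field \<Rightarrow> 'a::ring_1 \<Rightarrow> 'a" +
  fixes n :: nat and \<rho> :: "'a \<Rightarrow> 'k mat"
  assumes iso: "mat_algebra_iso scA n \<rho>"
begin

lemma rho_carrier [simp]: "\<rho> X \<in> carrier_mat n n"
  using iso unfolding mat_algebra_iso_def bij_betw_def by blast

lemma rho_dim [simp]: "dim_row (\<rho> X) = n" "dim_col (\<rho> X) = n"
  using carrier_matD[OF rho_carrier[of X]] by blast+

lemma rho_inj: "\<rho> X = \<rho> Y \<longleftrightarrow> X = Y"
  using iso unfolding mat_algebra_iso_def bij_betw_def by (auto dest: injD)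

lemma rho_one: "\<rho> 1 = 1\<^sub>m n"
  and rho_add: "\<rho> (X + Y) = \<rho> X + \<rho> Y"
  and rho_mult: "\<rho> (X * Y) = \<rho> X * \<rho> Y"
  and rho_scale: "\<rho> (scA c X) = c \<cdot>\<^sub>m \<rho> X"
  using iso unfolding mat_algebra_iso_def by blast+

lemma rho_zero: "\<rho> 0 = 0\<^sub>m n n"
proof -
  have "\<rho> (scA 0 0) = 0 \<cdot>\<^sub>m \<rho> 0" by (rule rho_scale)
  then show ?thesis by (auto simp: mat_eq_iff)
qed

lemma rho_mult_entry:
  "r < n \<Longrightarrow> c < n \<Longrightarrow> \<rho> (X * Y) $$ (r, c) = (\<Sum>k<n. \<rho> X $$ (r, k) * \<rho> Y $$ (k, c))"
  by (simp add: rho_mult scalar_prod_def atLeast0LessThan)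

lemma tr_scale: "tr \<rho> (scA c X) = c * tr \<rho> X"
  by (simp add: tr_def rho_scale sum_distrib_left)

lemma tr_comm: "tr \<rho> (X * Y) = tr \<rho> (Y * X)"
proof -
  have "tr \<rho> (X * Y) = (\<Sum>i<n. \<Sum>k<n. \<rho> X $$ (i, k) * \<rho> Y $$ (k, i))"
    by (simp add: tr_def rho_mult_entry)
  also have "\<dots> = (\<Sum>k<n. \<Sum>i<n. \<rho> X $$ (i, k) * \<rho> Y $$ (k, i))" by (rule sum.swap)
  also have "\<dots> = tr \<rho> (Y * X)"
    by (simp add: tr_def rho_mult_entry mult.commute)
  finally show ?thesis .
qed

text \<open>
  Phrased as a relation because it passes to sums, products and polynomials in the algebra;
  equations between elements are then checked on scalars instead of on sums of matrices.
\<close>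

definition scales :: "'k vec \<Rightarrow> 'a \<Rightarrow> 'k \<Rightarrow> bool" where
  "scales v X c \<longleftrightarrow> \<rho> X *\<^sub>v v = c \<cdot>\<^sub>v v"

context
  fixes v :: "'k vec"
  assumes v: "v \<in> carrier_vec n"
begin

lemma scales_one: "scales v 1 1"
  using v by (simp add: scales_def rho_one)

lemma scales_zero: "scales v 0 0"
  using v by (auto simp: scales_def rho_zero vec_eq_iff)

lemma scales_add: "scales v X a \<Longrightarrow> scales v Y b \<Longrightarrow> scales v (X + Y) (a + b)"
  using v by (simp add: scales_def rho_add add_mult_distrib_mat_vec[OF rho_carrier rho_carrier]
      add_smult_distrib_vec)

lemma scales_scale: "scales v X a \<Longrightarrow> scales v (scA c X) (c * a)"
  using v by (auto simp: scales_def rho_scale vec_eq_iff mult.assoc)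

lemma scales_mult: "scales v X a \<Longrightarrow> scales v Y b \<Longrightarrow> scales v (X * Y) (a * b)"
  using v by (simp add: scales_def rho_mult assoc_mult_mat_vec[OF rho_carrier rho_carrier]
      mult_mat_vec[OF rho_carrier] smult_smult_assoc mult.commute)

lemma scales_sum:
  "finite I \<Longrightarrow> (\<And>i. i \<in> I \<Longrightarrow> scales v (X i) (a i)) \<Longrightarrow> scales v (\<Sum>i\<in>I. X i) (\<Sum>i\<in>I. a i)"
  by (induction I rule: finite_induct) (auto intro: scales_zero scales_add)

lemma scales_power: "scales v X a \<Longrightarrow> scales v (X ^ k) (a ^ k)"
  by (induction k) (auto intro: scales_one scales_mult)

lemma scales_poly: "scales v X a \<Longrightarrow> scales v (poly_alg scA q X) (poly q a)"
  unfolding poly_alg_def poly_altdef by (intro scales_sum scales_scale scales_power) auto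

end

definition is_outer_product :: "'a \<Rightarrow> (nat \<Rightarrow> 'k) \<Rightarrow> (nat \<Rightarrow> 'k) \<Rightarrow> bool" where
  "is_outer_product F f g \<longleftrightarrow> (\<forall>r<n. \<forall>c<n. \<rho> F $$ (r, c) = f r * g c)"

lemma outer_left:
  assumes "is_outer_product F f g" "r < n" "c < n"
  shows "\<rho> (X * F) $$ (r, c) = (\<Sum>k<n. \<rho> X $$ (r, k) * f k) * g c"
  using assms by (simp add: rho_mult_entry is_outer_product_def sum_distrib_right mult.assoc)

lemma outer_right:
  assumes "is_outer_product F f g" "r < n" "c < n"
  shows "\<rho> (F * Y) $$ (r, c) = f r * (\<Sum>k<n. g k * \<rho> Y $$ (k, c))"
  using assms by (simp add: rho_mult_entry is_outer_product_def sum_distrib_left mult.assoc)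

lemma outer_mult_left: "is_outer_product F f g \<Longrightarrow> is_outer_product (X * F) (\<lambda>r. \<Sum>k<n. \<rho> X $$ (r, k) * f k) g"
  by (simp add: outer_left is_outer_product_def[of "X * F"])

lemma outer_compress:
  assumes F: "is_outer_product F f g"
  shows "F * X * F = scA (tr \<rho> (X * F)) F"
proof -
  have "\<rho> (F * (X * F)) = \<rho> (scA (tr \<rho> (X * F)) F)"
  proof (rule eq_matI)
    fix r c assume "r < dim_row (\<rho> (scA (tr \<rho> (X * F)) F))" "c < dim_col (\<rho> (scA (tr \<rho> (X * F)) F))"
    then have rc: "r < n" "c < n" by simp_all
    let ?h = "\<lambda>r. \<Sum>k<n. \<rho> X $$ (r, k) * f k"
    have "\<rho> (F * (X * F)) $$ (r, c) = f r * (\<Sum>k<n. g k * (?h k * g c))"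
      using rc by (simp add: outer_right[OF F] outer_left[OF F])
    also have "\<dots> = tr \<rho> (X * F) * (f r * g c)"
      by (simp add: tr_def outer_left[OF F] sum_distrib_left sum_distrib_right ac_simps)
    also have "\<dots> = \<rho> (scA (tr \<rho> (X * F)) F) $$ (r, c)"
      using F rc by (simp add: rho_scale is_outer_product_def)
    finally show "\<rho> (F * (X * F)) $$ (r, c) = \<rho> (scA (tr \<rho> (X * F)) F) $$ (r, c)" .
  qed simp_all
  then show ?thesis by (simp only: rho_inj mult.assoc)
qed

lemma nonzero_entry: "X \<noteq> 0 \<longleftrightarrow> (\<exists>r<n. \<exists>c<n. \<rho> X $$ (r, c) \<noteq> 0)"
proof -
  have "X = 0 \<longleftrightarrow> \<rho> X = 0\<^sub>m n n" using rho_inj[of X 0] by (simp add: rho_zero)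
  then show ?thesis by (auto simp: mat_eq_iff)
qed

lemma outer_nonzero:
  assumes F: "is_outer_product F f g" and X: "X * F \<noteq> 0" and Y: "F * Y \<noteq> 0"
  shows "X * F * Y \<noteq> 0"
proof -
  obtain r c where r: "r < n" "c < n" "\<rho> (X * F) $$ (r, c) \<noteq> 0" using X nonzero_entry by blast
  obtain r' c' where c: "r' < n" "c' < n" "\<rho> (F * Y) $$ (r', c') \<noteq> 0" using Y nonzero_entry by blast
  have "\<rho> (X * F * Y) $$ (r, c') \<noteq> 0"
    using r c unfolding outer_right[OF outer_mult_left[OF F] r(1) c(2)]
    by (auto simp: outer_left[OF F] outer_right[OF F])
  then show ?thesis using nonzero_entry r c by blast
qed

end

text \<open>
  A basis of column vectors \<open>v j\<close>, given by an inverse \<open>Q\<close> of the matrix that they form.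
\<close>

locale diagonalized = matrix_algebra +
  fixes v :: "nat \<Rightarrow> 'a vec" and Q :: "'a mat"
  assumes v_carrier: "j < n \<Longrightarrow> v j \<in> carrier_vec n"
    and Q_carrier: "Q \<in> carrier_mat n n"
    and Q_inverse: "mat n n (\<lambda>(r, c). v c $ r) * Q = 1\<^sub>m n"
begin

lemma entry_from_scales:
  assumes X: "\<And>j. j < n \<Longrightarrow> scales (v j) X (a j)" and rc: "r < n" "c < n"
  shows "\<rho> X $$ (r, c) = (\<Sum>j<n. a j * v j $ r * Q $$ (j, c))"
proof -
  let ?P = "mat n n (\<lambda>(r, c). v c $ r)"
  have XP: "\<rho> X * ?P = mat n n (\<lambda>(r, c). a c * v c $ r)"
  proof (rule eq_matI)
    fix i j assume "i < dim_row (mat n n (\<lambda>(r, c). a c * v c $ r))"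
      "j < dim_col (mat n n (\<lambda>(r, c). a c * v c $ r))"
    then have ij: "i < n" "j < n" by auto
    have "col ?P j = v j" using ij v_carrier[of j] by (auto simp: vec_eq_iff)
    then have "(\<rho> X * ?P) $$ (i, j) = (\<rho> X *\<^sub>v v j) $ i" using ij by simp
    also have "\<dots> = a j * v j $ i"
      using X[of j] ij v_carrier[of j] unfolding scales_def by simp
    finally show "(\<rho> X * ?P) $$ (i, j) = mat n n (\<lambda>(r, c). a c * v c $ r) $$ (i, j)"
      using ij by simp
  qed simp_all
  have "\<rho> X = \<rho> X * (?P * Q)" by (simp add: Q_inverse)
  also have "\<dots> = \<rho> X * ?P * Q"
    by (rule assoc_mult_mat[symmetric, OF rho_carrier _ Q_carrier]) simp
  finally have "\<rho> X $$ (r, c) = (mat n n (\<lambda>(r, c). a c * v c $ r) * Q) $$ (r, c)"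
    by (simp only: XP)
  also have "\<dots> = (\<Sum>j<n. a j * v j $ r * Q $$ (j, c))"
    using rc Q_carrier by (simp add: scalar_prod_def atLeast0LessThan)
  finally show ?thesis .
qed

lemma scales_unique:
  assumes "\<And>j. j < n \<Longrightarrow> scales (v j) X (a j)" "\<And>j. j < n \<Longrightarrow> scales (v j) Y (a j)"
  shows "X = Y"
proof -
  have "\<rho> X = \<rho> Y"
    using entry_from_scales[OF assms(1)] entry_from_scales[OF assms(2)] by (auto simp: mat_eq_iff)
  then show ?thesis by (simp add: rho_inj)
qed

lemma outer_from_scales:
  assumes i: "i < n" and X: "\<And>j. j < n \<Longrightarrow> scales (v j) X (if j = i then 1 else 0)"
  shows "is_outer_product X (\<lambda>r. v i $ r) (\<lambda>c. Q $$ (i, c))"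
  unfolding is_outer_product_def
proof (intro allI impI)
  fix r c assume rc: "r < n" "c < n"
  have "\<rho> X $$ (r, c) = (\<Sum>j<n. (if j = i then 1 else 0) * v j $ r * Q $$ (j, c))"
    by (rule entry_from_scales[OF X rc])
  also have "\<dots> = (\<Sum>j<n. if j = i then v i $ r * Q $$ (i, c) else 0)"
    by (rule sum.cong) auto
  finally have "\<rho> X $$ (r, c) = (\<Sum>j<n. if j = i then v i $ r * Q $$ (i, c) else 0)" .
  then show "\<rho> X $$ (r, c) = v i $ r * Q $$ (i, c)" using i by simp
qed

end

text \<open>
  Vectors that are separated by matrices \<open>F i\<close>, each fixing one of them and annihilating the
  others, are linearly independent: \<open>F i\<close> applied to a relation isolates its coefficient at \<open>v i\<close>.
\<close>

lemma separated_vectors_invertible: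
  fixes v :: "nat \<Rightarrow> 'k::field vec"
  assumes v: "\<And>j. j < n \<Longrightarrow> v j \<in> carrier_vec n" "\<And>j. j < n \<Longrightarrow> v j \<noteq> 0\<^sub>v n"
    and proj: "\<And>i j. i < n \<Longrightarrow> j < n \<Longrightarrow> F i *\<^sub>v v j = (if j = i then v j else 0\<^sub>v n)"
    and F: "\<And>i. i < n \<Longrightarrow> F i \<in> carrier_mat n n"
  shows "\<exists>Q \<in> carrier_mat n n. mat n n (\<lambda>(r, c). v c $ r) * Q = 1\<^sub>m n"
proof -
  let ?P = "mat n n (\<lambda>(r, c). v c $ r)"
  have P: "?P \<in> carrier_mat n n" by simp
  have "det ?P \<noteq> 0"
  proof
    assume "det ?P = 0"
    then obtain w where w: "w \<in> carrier_vec n" "w \<noteq> 0\<^sub>v n" "?P *\<^sub>v w = 0\<^sub>v n"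
      using det_0_iff_vec_prod_zero_field[OF P] by blast
    have "w $ i = 0" if i: "i < n" for i
    proof -
      have FP: "F i * ?P = mat n n (\<lambda>(r, c). if c = i then v i $ r else 0)"
      proof (rule eq_matI)
        fix r c assume "r < dim_row (mat n n (\<lambda>(r, c). if c = i then v i $ r else 0))"
          "c < dim_col (mat n n (\<lambda>(r, c). if c = i then v i $ r else 0))"
        then have rc: "r < n" "c < n" by auto
        have "col ?P c = v c" using rc v(1)[of c] by (auto simp: vec_eq_iff)
        then have "(F i * ?P) $$ (r, c) = (F i *\<^sub>v v c) $ r" using rc F[OF i] by simp
        then show "(F i * ?P) $$ (r, c) = mat n n (\<lambda>(r, c). if c = i then v i $ r else 0) $$ (r, c)"
          using rc i by (simp add: proj)
      qed (use F[OF i] in simp_all)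
      have "0\<^sub>v n = F i *\<^sub>v (?P *\<^sub>v w)" using F[OF i] by (auto simp: w(3) vec_eq_iff)
      also have "\<dots> = (F i * ?P) *\<^sub>v w" by (rule assoc_mult_mat_vec[symmetric, OF F[OF i] P w(1)])
      finally have z: "0\<^sub>v n = mat n n (\<lambda>(r, c). if c = i then v i $ r else 0) *\<^sub>v w" by (simp only: FP)
      obtain r where r: "r < n" "v i $ r \<noteq> 0"
        using v[OF i] by (auto simp: vec_eq_iff)
      have "0 = (mat n n (\<lambda>(r, c). if c = i then v i $ r else 0) *\<^sub>v w) $ r"
        using z r by (metis index_zero_vec(1))
      also have "\<dots> = (\<Sum>c<n. (if c = i then v i $ r else 0) * w $ c)"
        using r w(1) by (simp add: scalar_prod_def atLeast0LessThan)
      also have "\<dots> = (\<Sum>c<n. if c = i then v i $ r * w $ i else 0)"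
        by (rule sum.cong) auto
      also have "\<dots> = v i $ r * w $ i" using i by simp
      finally show ?thesis using r by simp
    qed
    then show False using w by (auto simp: vec_eq_iff)
  qed
  from det_non_zero_imp_unit[OF P this, of "()"]
  show ?thesis unfolding Units_def ring_mat_def by auto
qed

text \<open>
  The eigenvectors of a multiplicity-free element form a basis, in which every polynomial of
  the element is diagonal and the primitive idempotents are the diagonal matrix units.
  Equations are therefore checked on the eigenvectors, and a matrix unit has rank one.
\<close>

lemma prim_idem_resolution:
  fixes scA :: "'k::field \<Rightarrow> 'a::ring_1 \<Rightarrow> 'a"
  assumes alg: "field_algebra scA" and iso: "mat_algebra_iso scA (d + 1) \<rho>"
    and mf: "multiplicity_free \<rho> (d + 1) A"
    and bij: "bij_betw E {0..d} (prim_idem scA \<rho> A ` spec \<rho> A)"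
    and eig: "\<forall>i\<le>d. \<theta> i \<in> spec \<rho> A \<and> E i = prim_idem scA \<rho> A (\<theta> i)"
  shows "rank_one_resolution scA (tr \<rho>) d A E \<theta>"
proof -
  interpret matrix_algebra scA "d + 1" \<rho>
    using alg iso by (simp add: matrix_algebra_def matrix_algebra_axioms_def)
  have inj: "inj_on \<theta> {..d}"
  proof (rule inj_onI)
    fix i j assume ij: "i \<in> {..d}" "j \<in> {..d}" and "\<theta> i = \<theta> j"
    then have "E i = E j" using eig by simp
    then show "i = j" using ij bij by (auto simp: bij_betw_def dest: inj_onD)
  qed
  have card: "card (spec \<rho> A) = d + 1" using mf by (simp add: multiplicity_free_def)
  then have fin: "finite (spec \<rho> A)" by (metis add_is_0 card.infinite one_neq_zero)
  have spec: "\<theta> ` {..d} = spec \<rho> A"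
    by (rule card_subset_eq[OF fin]) (use eig card inj in \<open>auto simp: card_image\<close>)
  have "\<forall>j. \<exists>w. j \<le> d \<longrightarrow> eigenvector (\<rho> A) w (\<theta> j)"
    using eig unfolding spec_def eigenvalue_def by blast
  then obtain v where v: "\<And>j. j \<le> d \<Longrightarrow> eigenvector (\<rho> A) (v j) (\<theta> j)" by metis
  have vc: "v j \<in> carrier_vec (d + 1)" "v j \<noteq> 0\<^sub>v (d + 1)" "scales (v j) A (\<theta> j)" if "j < d + 1" for j
    using v[of j] that by (simp_all add: eigenvector_def scales_def)
  have sE: "scales (v j) (E i) (if j = i then 1 else 0)" if ij: "i < d + 1" "j < d + 1" for i j
  proof -
    let ?p = "\<Prod>\<mu>\<in>spec \<rho> A - {\<theta> i}. Polynomial.smult (inverse (\<theta> i - \<mu>)) [:- \<mu>, 1:]"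
    have "scales (v j) (E i) (poly ?p (\<theta> j))"
      using scales_poly[OF vc(1) vc(3)] ij eig by (simp add: prim_idem_def)
    moreover have "poly ?p (\<theta> j) = (\<Prod>\<mu>\<in>spec \<rho> A - {\<theta> i}. inverse (\<theta> i - \<mu>) * (\<theta> j - \<mu>))"
      by (simp add: poly_prod algebra_simps)
    moreover have "\<dots> = (if j = i then 1 else 0)"
    proof (cases "j = i")
      case False
      then have "\<theta> j \<noteq> \<theta> i" using ij inj by (auto dest: inj_onD)
      moreover have "\<theta> j \<in> spec \<rho> A" using eig ij by simp
      ultimately show ?thesis using False fin by (auto intro!: prod_zero bexI[of _ "\<theta> j"])
    next
      case True
      then show ?thesis by (simp, intro prod.neutral ballI left_inverse) auto
    qed
    ultimately show ?thesis by simp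
  qed
  have "\<exists>Q \<in> carrier_mat (d + 1) (d + 1). mat (d + 1) (d + 1) (\<lambda>(r, c). v c $ r) * Q = 1\<^sub>m (d + 1)"
  proof (rule separated_vectors_invertible)
    fix i j assume "i < d + 1" "j < d + 1"
    then show "\<rho> (E i) *\<^sub>v v j = (if j = i then v j else 0\<^sub>v (d + 1))"
      using sE[of i j] vc(1)[of j] unfolding scales_def by (auto simp: vec_eq_iff)
  qed (use vc rho_carrier in auto)
  then obtain Q where Q: "Q \<in> carrier_mat (d + 1) (d + 1)"
    "mat (d + 1) (d + 1) (\<lambda>(r, c). v c $ r) * Q = 1\<^sub>m (d + 1)" by blast
  interpret diagonalized scA "d + 1" \<rho> v Q
    by unfold_locales (use vc Q in auto)
  have outer: "is_outer_product (E i) (\<lambda>r. v i $ r) (\<lambda>c. Q $$ (i, c))" if "i \<le> d" for i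
    using outer_from_scales[of i] sE that by simp
  show ?thesis
  proof unfold_locales
    show "E i \<noteq> 0" if "i \<le> d" for i
    proof
      assume "E i = 0"
      then have "0 \<cdot>\<^sub>v v i = 1 \<cdot>\<^sub>v v i"
        using sE[of i i] scales_zero[OF vc(1)[of i]] that by (simp add: scales_def)
      then show False using vc[of i] that by (auto simp: vec_eq_iff)
    qed
    show "E i * E j = (if i = j then E i else 0)" if "i \<le> d" "j \<le> d" for i j
    proof (rule scales_unique)
      fix k assume k: "k < d + 1"
      show "scales (v k) (E i * E j) ((if k = i then 1 else 0) * (if k = j then 1 else 0))"
        using that k by (intro scales_mult sE vc(1)) auto
      show "scales (v k) (if i = j then E i else 0) ((if k = i then 1 else 0) * (if k = j then 1 else 0))"
        using sE[of i k] scales_zero[OF vc(1)[OF k]] that k by auto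
    qed
    show "poly_alg scA q A = (\<Sum>i\<le>d. scA (poly q (\<theta> i)) (E i))" for q
    proof (rule scales_unique)
      fix k assume k: "k < d + 1"
      show "scales (v k) (poly_alg scA q A) (poly q (\<theta> k))"
        by (rule scales_poly[OF vc(1)[OF k] vc(3)[OF k]])
      have "scales (v k) (\<Sum>i\<le>d. scA (poly q (\<theta> i)) (E i))
          (\<Sum>i\<le>d. poly q (\<theta> i) * (if k = i then 1 else 0))"
        using k by (intro scales_sum scales_scale sE vc(1)) auto
      also have "(\<Sum>i\<le>d. poly q (\<theta> i) * (if k = i then 1 else 0)) = poly q (\<theta> k)"
        using k by (simp add: if_distrib[of "\<lambda>x. _ * x"] cong: if_cong)
      finally show "scales (v k) (\<Sum>i\<le>d. scA (poly q (\<theta> i)) (E i)) (poly q (\<theta> k))" .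
    qed
    show "E i * X * E i = scA (tr \<rho> (X * E i)) (E i)" if "i \<le> d" for i X
      by (rule outer_compress[OF outer[OF that]])
    show "X * E i * Y \<noteq> 0" if "i \<le> d" "X * E i \<noteq> 0" "E i * Y \<noteq> 0" for i X Y
      by (rule outer_nonzero[OF outer[OF that(1)] that(2,3)])
  qed (rule inj tr_scale tr_comm)+
qed

section \<open>Modules with an invariant form\<close>

context left_algebra_module
begin

lemma act_zero_left [simp]: "act 0 v = 0"
  using act_add_left[of 0 0 v] by simp

lemma act_scale_right: "act X (scV c v) = scV c (act X v)"
proof -
  have "act X (scV c v) = act X (act (scA c 1) v)" by (simp add: act_scale act_one)
  also have "\<dots> = act (scA c X) v" by (simp add: act_mult[symmetric] scale_mult_right)
  finally show ?thesis by (simp add: act_scale)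
qed

text \<open>
  The common skeleton of all the identities: as soon as \<open>Z r * Y\<close> is biorthogonal on the image
  of \<open>F\<close>, the sum keeps the term \<open>X i\<close> only, whatever the sequence \<open>X\<close> is.
\<close>

lemma act_select:
  fixes d i :: nat
  assumes G: "\<And>r. r \<le> d \<Longrightarrow> G r = X r * Z r"
    and Z: "\<And>r. r \<le> d \<Longrightarrow> Z r * Y * F = (if r = i then W else 0)"
    and i: "i \<le> d" and \<xi>: "act F \<xi> = \<xi>"
  shows "act (scA c (\<Sum>r = 0..d. G r)) (act Y \<xi>) = scV c (act (X i) (act W \<xi>))"
proof -
  have "(\<Sum>r = 0..d. G r) * Y * F = (\<Sum>r = 0..d. X r * (Z r * Y * F))"
    by (simp add: sum_distrib_right mult.assoc G)
  also have "\<dots> = (\<Sum>r = 0..d. if r = i then X i * W else 0)"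
    using Z by (intro sum.cong) auto
  also have "\<dots> = X i * W" using i by simp
  finally have eq: "(\<Sum>r = 0..d. G r) * Y * F = X i * W" .
  have "act (scA c (\<Sum>r = 0..d. G r)) (act Y \<xi>) = scV c (act (\<Sum>r = 0..d. G r) (act Y (act F \<xi>)))"
    by (simp add: act_scale \<xi>)
  also have "\<dots> = scV c (act ((\<Sum>r = 0..d. G r) * Y * F) \<xi>)" by (simp add: act_mult)
  finally show ?thesis by (simp add: eq act_mult)
qed

end

text \<open>
  The orbit of a vector is a submodule, and it contains the vector.
\<close>

lemma (in irreducible_algebra_module) generated_by_nonzero:
  assumes "v \<noteq> 0"
  obtains X where "w = act X v"
proof -
  let ?W = "range (\<lambda>X. act X v)"
  have "V.subspace ?W"
  proof (rule V.subspaceI)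
    show "0 \<in> ?W" using rangeI[of "\<lambda>X. act X v" 0] by simp
    show "x + y \<in> ?W" if "x \<in> ?W" "y \<in> ?W" for x y
      using that by (auto simp: act_add_left[symmetric])
    show "scV c x \<in> ?W" if "x \<in> ?W" for c x
      using that by (auto simp: act_scale[symmetric])
  qed
  moreover have "act X w \<in> ?W" if "w \<in> ?W" for X w
    using that by (auto simp: act_mult[symmetric])
  ultimately have "?W = {0} \<or> ?W = UNIV" by (rule irreducible)
  moreover have "v \<in> ?W" using rangeI[of "\<lambda>X. act X v" 1] by (simp add: act_one)
  ultimately show ?thesis using assms that by blast
qed

locale invariant_form = irreducible_algebra_module scA scV act
  for scA :: "'k::field \<Rightarrow> 'a::ring_1 \<Rightarrow> 'a" and scV :: "'k \<Rightarrow> 'v::ab_group_add \<Rightarrow> 'v"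
    and act :: "'a \<Rightarrow> 'v \<Rightarrow> 'v" +
  fixes dag :: "'a \<Rightarrow> 'a" and bf :: "'v \<Rightarrow> 'v \<Rightarrow> 'k"
  assumes bilinear: "bilinear_form scV bf" and form_nonzero: "\<exists>u v. bf u v \<noteq> 0"
    and adjoint: "bf (act X u) v = bf u (act (dag X) v)"
begin

lemma form_add_left: "bf (u + u') v = bf u v + bf u' v"
  and form_scale_left: "bf (scV c u) v = c * bf u v"
  and form_scale_right: "bf u (scV c v) = c * bf u v"
  using bilinear unfolding bilinear_form_def Vector_Spaces.linear_def module_hom_def module_hom_axioms_def
  by blast+

lemma form_zero_left: "bf 0 v = 0"
  using form_scale_left[of 0 0 v] by simp

text \<open>
  The left radical of the form is a submodule, and it is not the whole space.
\<close>

lemma form_nondegenerate: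
  assumes "\<And>v. bf u v = 0"
  shows "u = 0"
proof -
  let ?W = "{u. \<forall>v. bf u v = 0}"
  have "V.subspace ?W"
    by (rule V.subspaceI) (auto simp: form_zero_left form_add_left form_scale_left)
  moreover have "act X w \<in> ?W" if "w \<in> ?W" for X w
    using that by (simp add: adjoint)
  ultimately have "?W = {0} \<or> ?W = UNIV" by (rule irreducible)
  then show ?thesis using form_nonzero assms by blast
qed

context
  fixes F :: 'a and t :: "'a \<Rightarrow> 'k" and \<xi> :: 'v
  assumes self_adjoint: "dag F = F" and fixed: "act F \<xi> = \<xi>" and \<xi>: "\<xi> \<noteq> 0"
    and compress: "\<And>X. F * X * F = scA (t (X * F)) F"
begin

lemma image_multiple: "\<exists>c. act F w = scV c \<xi>"
proof -
  obtain X where "w = act X \<xi>" using generated_by_nonzero[OF \<xi>] .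
  then have "act F w = act (F * X * F) \<xi>" by (simp add: act_mult fixed)
  then show ?thesis by (auto simp: compress act_scale fixed)
qed

lemma form_self_nonzero: "bf \<xi> \<xi> \<noteq> 0"
proof
  assume z: "bf \<xi> \<xi> = 0"
  have "bf \<xi> v = 0" for v
  proof -
    have "bf \<xi> v = bf \<xi> (act F v)" using adjoint[of F \<xi> v] by (simp add: self_adjoint fixed)
    moreover obtain c where "act F v = scV c \<xi>" using image_multiple by blast
    ultimately show ?thesis by (simp add: form_scale_right z)
  qed
  then show False using form_nondegenerate \<xi> by blast
qed

text \<open>
  A self-adjoint idempotent of rank one acts as the orthogonal projection onto its image.
\<close>

lemma project_by_form: "act F w = scV (bf w \<xi> / bf \<xi> \<xi>) \<xi>"
proof -
  obtain c where c: "act F w = scV c \<xi>" using image_multiple by blast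
  have "bf w \<xi> = bf (act F w) \<xi>" using adjoint[of F w \<xi>] by (simp add: self_adjoint fixed)
  then have "bf w \<xi> = c * bf \<xi> \<xi>" by (simp add: c form_scale_left)
  then show ?thesis using c form_self_nonzero by simp
qed

end

end

section \<open>The transition identities\<close>

text \<open>
  A Leonard system with an invariant form, both split sequences and a nonzero vector in
  each of the four extremal eigenspaces, which is expressed by the idempotent fixing the vector.
\<close>

locale leonard_form = invariant_form scA scV act dag bf + leonard_pair scA t d A E \<theta> As Es \<theta>s
  for scA :: "'k::field \<Rightarrow> 'a::ring_1 \<Rightarrow> 'a" and scV :: "'k \<Rightarrow> 'v::ab_group_add \<Rightarrow> 'v"
    and act :: "'a \<Rightarrow> 'v \<Rightarrow> 'v" and dag :: "'a \<Rightarrow> 'a" and bf :: "'v \<Rightarrow> 'v \<Rightarrow> 'k"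
    and t d A E \<theta> As Es \<theta>s +
  fixes vphi phi :: "nat \<Rightarrow> 'k" and \<xi>0 \<xi>d \<xi>s0 \<xi>sd :: 'v
  assumes dag_idem: "i \<le> d \<Longrightarrow> dag (E i) = E i" "i \<le> d \<Longrightarrow> dag (Es i) = Es i"
    and vphi: "i \<in> {1..d} \<Longrightarrow> vphi i = (\<theta>s 0 - \<theta>s i) *
        (t (pA (tau_poly \<theta> i) * Es 0) / t (pA (tau_poly \<theta> (i - 1)) * Es 0))"
    and phi: "i \<in> {1..d} \<Longrightarrow> phi i = (\<theta>s 0 - \<theta>s i) *
        (t (pA (eta_poly d \<theta> i) * Es 0) / t (pA (eta_poly d \<theta> (i - 1)) * Es 0))"
    and fixed: "act (E 0) \<xi>0 = \<xi>0" "act (E d) \<xi>d = \<xi>d" "act (Es 0) \<xi>s0 = \<xi>s0" "act (Es d) \<xi>sd = \<xi>sd"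
    and nz: "\<xi>0 \<noteq> 0" "\<xi>d \<noteq> 0" "\<xi>s0 \<noteq> 0" "\<xi>sd \<noteq> 0"
begin

lemmas vphi_product = split_product[OF _ vphi]

lemma vphi_product_nonzero: "r \<le> d \<Longrightarrow> (\<Prod>k=1..r. vphi k) \<noteq> 0"
  using vphi_product[of r] split_product_nonzero[of r] by simp

lemma vphi_total:
  "(\<Prod>k=1..d. vphi k) = (\<Prod>k=1..d. \<theta>s 0 - \<theta>s k) * (poly (tau_poly \<theta> d) (\<theta> d) * t (E d * Es 0))"
  using vphi_product[of d] by (simp add: last_tau L.scale_mult L.trace_scale)

text \<open>
  The second split sequence is the first one of the system with \<open>E\<close> reversed, for which
  \<open>tau_poly\<close> becomes \<open>eta_poly\<close>; the corner exchange then moves it from \<open>Es 0\<close> to \<open>Es d\<close>.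
\<close>

lemma phi_total:
  "(\<Prod>k=1..d. phi k) = poly (tau_poly \<theta> d) (\<theta> d) * poly (tau_poly \<theta>s d) (\<theta>s d) * t (Es d * E d)"
  "(\<Prod>k=1..d. phi k) \<noteq> 0" "t (E 0 * Es 0) \<noteq> 0"
proof -
  interpret R: leonard_pair scA t d A "\<lambda>i. E (d - i)" "\<lambda>i. \<theta> (d - i)" As Es \<theta>s
    by (rule leonard_pair_reverse) (rule leonard_pair_axioms)
  have tau: "tau_poly (\<lambda>i. \<theta> (d - i)) = eta_poly d \<theta>"
    by (simp add: fun_eq_iff tau_poly_def eta_poly_def)
  have "(\<Prod>k=1..d. phi k) = (\<Prod>k=1..d. \<theta>s 0 - \<theta>s k) * t (pA (eta_poly d \<theta> d) * Es 0)"
    using R.split_product[of d phi] phi by (simp add: tau)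
  also have last: "pA (eta_poly d \<theta> d) = scA (\<Prod>k=1..d. \<theta> 0 - \<theta> k) (E 0)"
    using R.last_tau unfolding tau eigenvalue_product_flip by simp
  finally have "(\<Prod>k=1..d. phi k) = (\<Prod>k=1..d. \<theta>s 0 - \<theta>s k) * (\<Prod>k=1..d. \<theta> 0 - \<theta> k) * t (E 0 * Es 0)"
    by (simp add: L.scale_mult L.trace_scale)
  moreover have nonz: "(\<Prod>k=1..d. \<theta>s 0 - \<theta>s k) * ((\<Prod>k=1..d. \<theta> 0 - \<theta> k) * t (E 0 * Es 0)) \<noteq> 0"
    using R.split_product_nonzero[of d] unfolding tau last L.scale_mult L.trace_scale by simp
  ultimately show "(\<Prod>k=1..d. phi k) = poly (tau_poly \<theta> d) (\<theta> d) * poly (tau_poly \<theta>s d) (\<theta>s d) * t (Es d * E d)"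
    "(\<Prod>k=1..d. phi k) \<noteq> 0" "t (E 0 * Es 0) \<noteq> 0"
    using trace_corner_exchange by auto
qed

lemmas project_E = project_by_form[OF dag_idem(1) _ _ L.compress]
lemmas project_Es = project_by_form[OF dag_idem(2) _ _ S.compress]

lemma forms_nonzero: "bf \<xi>s0 \<xi>s0 \<noteq> 0" "bf \<xi>sd \<xi>sd \<noteq> 0" "bf \<xi>0 \<xi>s0 \<noteq> 0" "bf \<xi>0 \<xi>sd \<noteq> 0"
proof -
  show "bf \<xi>s0 \<xi>s0 \<noteq> 0" "bf \<xi>sd \<xi>sd \<noteq> 0"
    using form_self_nonzero[OF dag_idem(2) fixed(3) nz(3) S.compress]
      form_self_nonzero[OF dag_idem(2) fixed(4) nz(4) S.compress] by simp_all
  have "bf \<xi>0 \<xi> \<noteq> 0" if i: "i \<le> d" and \<xi>: "act (Es i) \<xi> = \<xi>" "\<xi> \<noteq> 0" for i \<xi>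
  proof
    assume "bf \<xi>0 \<xi> = 0"
    then have "act (Es i) \<xi>0 = 0" using project_Es[OF i \<xi> i] by simp
    \<comment> \<open>The trace in this compression is nonzero, as \<open>E 0 * Es i\<close> and \<open>Es i * E 0\<close> are.\<close>
    then have "act (E 0 * Es i * E 0) \<xi>0 = 0"
      using act_scale_right[of "E 0" 0 0] by (simp add: act_mult fixed)
    then have "t (Es i * E 0) = 0"
      using nz by (simp add: L.compress act_scale fixed)
    then have "E 0 * Es i * E 0 = 0" by (simp add: L.compress)
    moreover have "E 0 * Es i * E 0 \<noteq> 0"
      using S.rank_one_nonzero[OF i] idem_products_nonzero[OF i] idem_products_nonzero'[OF i] by blast
    ultimately show False by simp
  qed
  from this[of 0 \<xi>s0] this[of d \<xi>sd] show "bf \<xi>0 \<xi>s0 \<noteq> 0" "bf \<xi>0 \<xi>sd \<noteq> 0"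
    using fixed nz by auto
qed

lemma scaled_biorthogonal:
  assumes "r \<le> d" "i \<le> d"
  shows "scA (inverse (\<Prod>k=1..r. vphi k)) (Es 0 * pA (tau_poly \<theta> r)) * pS (tau_poly \<theta>s i) * E 0 =
    (if r = i then Es 0 * E 0 else 0)"
proof -
  have inv: "inverse (\<Prod>k=1..r. vphi k) * (\<Prod>k=1..r. vphi k) = 1"
    by (rule left_inverse[OF vphi_product_nonzero[OF assms(1)]])
  have "scA (inverse (\<Prod>k=1..r. vphi k)) (Es 0 * pA (tau_poly \<theta> r)) * pS (tau_poly \<theta>s i) * E 0 =
      scA (inverse (\<Prod>k=1..r. vphi k)) (Es 0 * pA (tau_poly \<theta> r) * pS (tau_poly \<theta>s i) * E 0)"
    by (simp add: L.scale_mult)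
  also have "\<dots> = (if r = i then Es 0 * E 0 else 0)"
  proof (cases "r = i")
    case True
    then have "Es 0 * pA (tau_poly \<theta> r) * pS (tau_poly \<theta>s i) * E 0 = scA (\<Prod>k=1..r. vphi k) (Es 0 * E 0)"
      using split_biorthogonal[OF assms] vphi_product[OF assms(1)] by simp
    then show ?thesis using True inv by (simp only: scale_scale scale_one if_True simp_thms)
  next
    case False
    then show ?thesis using split_biorthogonal[OF assms] by simp
  qed
  finally show ?thesis .
qed

text \<open>
  Biorthogonality leaves \<open>X i\<close> applied to the projection of \<open>\<xi>0\<close> by \<open>Es 0\<close>, and the quotient of
  forms in front turns this projection into \<open>\<xi>s0\<close>.
\<close>

lemma transition_star_0:
  assumes i: "i \<le> d"
  shows "act (scA (bf \<xi>s0 \<xi>s0 / bf \<xi>0 \<xi>s0)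
      (\<Sum>r = 0..d. scA (inverse (\<Prod>k = 1..r. vphi k)) (X r * Es 0 * pA (tau_poly \<theta> r))))
      (act (pS (tau_poly \<theta>s i)) \<xi>0) = act (X i) \<xi>s0"
proof -
  have "act (Es 0 * E 0) \<xi>0 = scV (bf \<xi>0 \<xi>s0 / bf \<xi>s0 \<xi>s0) \<xi>s0"
    using project_Es[OF _ fixed(3) nz(3)] by (simp add: act_mult fixed)
  then show ?thesis using forms_nonzero
    by (subst act_select[OF _ scaled_biorthogonal i fixed(1), where X = X])
      (simp_all add: i L.scale_mult mult.assoc act_scale_right)
qed

text \<open>
  Here the corner is evaluated with \<open>Es d\<close>, so that rank one leaves
  \<open>Es d * E 0\<close> times the trace that occurs in the product of the second split sequence.
\<close>

lemma transition_star_d: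
  assumes i: "i \<le> d"
  shows "act (scA (poly (tau_poly \<theta> d) (\<theta> d) / (\<Prod>k = 1..d. phi k) * (bf \<xi>sd \<xi>sd / bf \<xi>0 \<xi>sd))
      (\<Sum>r = 0..d. X r * Es d * E d * pS (eta_poly d \<theta>s (d - r))))
      (act (pS (tau_poly \<theta>s i)) \<xi>0) = act (X i) \<xi>sd"
proof -
  let ?W = "Es d * (E d * As ^ d * E 0)"
  have sel: "Es d * E d * pS (eta_poly d \<theta>s (d - r)) * pS (tau_poly \<theta>s i) * E 0 = (if r = i then ?W else 0)"
    if "r \<le> d" for r
  proof -
    have "Es d * E d * pS (eta_poly d \<theta>s (d - r)) * pS (tau_poly \<theta>s i) * E 0 =
        Es d * (E d * pS (eta_poly d \<theta>s (d - r)) * pS (tau_poly \<theta>s i) * E 0)"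
      by (simp only: mult.assoc)
    then show ?thesis by (simp add: corner_biorthogonal[OF that i])
  qed
  have "?W = scA (poly (tau_poly \<theta>s d) (\<theta>s d)) (Es d * E d * Es d * E 0)"
    unfolding corner_star_last by (simp add: L.scale_mult mult.assoc)
  also have "\<dots> = scA (poly (tau_poly \<theta>s d) (\<theta>s d) * t (Es d * E d)) (Es d * E 0)"
    by (simp add: S.compress L.scale_mult L.trace_comm[of "E d"])
  finally have "act ?W \<xi>0 = scV (poly (tau_poly \<theta>s d) (\<theta>s d) * t (Es d * E d) * (bf \<xi>0 \<xi>sd / bf \<xi>sd \<xi>sd)) \<xi>sd"
    using project_Es[OF _ fixed(4) nz(4)] by (simp add: act_scale act_mult fixed)
  then show ?thesis using forms_nonzero phi_total(1,2)
    by (subst act_select[OF _ sel i fixed(1), where X = X])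
      (simp_all add: mult.assoc act_scale_right)
qed

text \<open>
  The vector \<open>\<xi>0\<close> is projected by \<open>Es 0\<close> and back by \<open>E 0\<close>, which multiplies it by the trace
  of \<open>E 0 * Es 0\<close>.
\<close>

lemma transition_0:
  assumes i: "i \<le> d"
  shows "act (scA (1 / t (E 0 * Es 0))
      (\<Sum>r = 0..d. scA (inverse (\<Prod>k = 1..r. vphi k)) (X r * E 0 * Es 0 * pA (tau_poly \<theta> r))))
      (act (pS (tau_poly \<theta>s i)) \<xi>0) = act (X i) \<xi>0"
proof -
  have "act (Es 0 * E 0) \<xi>0 = act (Es 0) \<xi>0" by (simp add: act_mult fixed)
  moreover have "act (E 0) (act (Es 0) \<xi>0) = act (E 0 * Es 0 * E 0) \<xi>0"
    by (simp add: act_mult fixed)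
  then have "act (E 0) (act (Es 0) \<xi>0) = scV (t (E 0 * Es 0)) \<xi>0"
    by (simp add: L.compress act_scale fixed L.trace_comm[of "Es 0"])
  ultimately show ?thesis using phi_total(3)
    by (subst act_select[OF _ scaled_biorthogonal i fixed(1), where X = "\<lambda>r. X r * E 0"])
      (simp_all add: i L.scale_mult mult.assoc act_scale_right act_mult)
qed

text \<open>
  Here the corner is evaluated with \<open>Es 0\<close>: it projects \<open>\<xi>0\<close> to a multiple of \<open>\<xi>s0\<close>, and this
  to a multiple of \<open>\<xi>d\<close>.
  The two coefficients of projection between \<open>\<xi>s0\<close> and \<open>\<xi>d\<close> multiply to the trace of
  \<open>E d * Es 0\<close>, which cancels against the product of the first split sequence.
\<close>

lemma transition_d:
  assumes i: "i \<le> d"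
  shows "act (scA (poly (tau_poly \<theta> d) (\<theta> d) / (\<Prod>k = 1..d. vphi k) * (bf \<xi>d \<xi>s0 / bf \<xi>0 \<xi>s0))
      (\<Sum>r = 0..d. X r * E d * pS (eta_poly d \<theta>s (d - r))))
      (act (pS (tau_poly \<theta>s i)) \<xi>0) = act (X i) \<xi>d"
proof -
  let ?a = "poly (tau_poly \<theta> d) (\<theta> d)" and ?b = "\<Prod>k=1..d. \<theta>s 0 - \<theta>s k"
  let ?e = "bf \<xi>s0 \<xi>d / bf \<xi>d \<xi>d"
  have e: "act (E d) \<xi>s0 = scV ?e \<xi>d"
    by (rule project_E) (simp_all add: fixed nz)
  have p: "act (Es 0) w = scV (bf w \<xi>s0 / bf \<xi>s0 \<xi>s0) \<xi>s0" for w
    by (rule project_Es) (simp_all add: fixed nz)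
  have "act (Es 0 * E d * Es 0) \<xi>s0 = scV (?e * (bf \<xi>d \<xi>s0 / bf \<xi>s0 \<xi>s0)) \<xi>s0"
    by (simp add: act_mult fixed e act_scale_right p[of \<xi>d])
  moreover have "act (Es 0 * E d * Es 0) \<xi>s0 = scV (t (E d * Es 0)) \<xi>s0"
    by (simp add: S.compress act_scale fixed)
  ultimately have te: "t (E d * Es 0) = ?e * (bf \<xi>d \<xi>s0 / bf \<xi>s0 \<xi>s0)"
    using nz(3) by (metis V.scale_right_imp_eq)
  have W: "act (E d * As ^ d * E 0) \<xi>0 = scV (?b * (bf \<xi>0 \<xi>s0 / bf \<xi>s0 \<xi>s0) * ?e) \<xi>d"
    by (simp add: corner_star_first act_scale act_mult fixed p[of \<xi>0] act_scale_right e)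
  have tot: "(\<Prod>k=1..d. vphi k) = ?b * (?a * (?e * (bf \<xi>d \<xi>s0 / bf \<xi>s0 \<xi>s0)))"
    by (simp only: vphi_total te)
  have sc: "?a / (\<Prod>k = 1..d. vphi k) * (bf \<xi>d \<xi>s0 / bf \<xi>0 \<xi>s0) *
      (?b * (bf \<xi>0 \<xi>s0 / bf \<xi>s0 \<xi>s0) * ?e) = 1"
  proof -
    have "?a / P * (x / y) * (?b * (y / z) * e) = 1" if "y \<noteq> 0" "P \<noteq> 0" "P = ?b * (?a * (e * (x / z)))"
      for P x y z e :: 'k
    proof -
      have "?a / P * (x / y) * (?b * (y / z) * e) = (?b * (?a * (e * (x / z)))) / P * (y / y)"
        by (simp only: times_divide_eq_left times_divide_eq_right divide_divide_eq_left ac_simps)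
      also have "\<dots> = P / P * (y / y)" by (simp only: that(3)[symmetric])
      finally show ?thesis using that(1,2) by simp
    qed
    from this[OF forms_nonzero(3) vphi_product_nonzero[OF order_refl] tot] show ?thesis .
  qed
  show ?thesis
    by (subst act_select[OF _ corner_biorthogonal i fixed(1), where X = X])
      (simp_all only: i mult.assoc W[unfolded mult.assoc] act_scale_right V.scale_scale sc[unfolded mult.assoc] V.scale_one)
qed

end

lemma dag_poly_alg:
  assumes dag: "antiautomorphism scA dag" and A: "dag A = A"
  shows "dag (poly_alg scA q A) = poly_alg scA q A"
proof -
  have lin: "Vector_Spaces.linear scA scA dag" and bij: "bij dag"
    and mult: "\<And>X Y. dag (X * Y) = dag Y * dag X"
    using dag unfolding antiautomorphism_def by auto
  interpret Vector_Spaces.linear scA scA dag by (rule lin)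
  \<comment> \<open>The element \<open>dag 1\<close> is neutral for the image of \<open>dag\<close>, which contains 1.\<close>
  obtain u where u: "dag u = 1" using surjD[OF bij_is_surj[OF bij], of 1] by metis
  have one: "dag 1 = 1" using mult[of 1 u] u by simp
  have pow: "dag (A ^ k) = A ^ k" for k
    by (induction k) (simp_all add: one mult A power_commutes)
  show ?thesis by (simp add: poly_alg_def sum scale pow)
qed

theorem theorem18p1:
  fixes d :: nat
    and scA :: "'k::field \<Rightarrow> 'a::ring_1 \<Rightarrow> 'a"
    and scV :: "'k \<Rightarrow> 'v::ab_group_add \<Rightarrow> 'v"
    and act :: "'a \<Rightarrow> 'v \<Rightarrow> 'v"
    and \<rho> :: "'a \<Rightarrow> 'k mat"
    and A As :: 'a and E Es :: "nat \<Rightarrow> 'a"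
    and \<theta> \<theta>s vphi phi :: "nat \<Rightarrow> 'k"
    and dag :: "'a \<Rightarrow> 'a"
    and bf :: "'v \<Rightarrow> 'v \<Rightarrow> 'k"
    and \<xi>0 \<xi>d \<xi>s0 \<xi>sd :: 'v
  assumes "field_algebra scA"
    and "mat_algebra_iso scA (d + 1) \<rho>"
    and "irreducible_algebra_module scA scV act"
    and "leonard_system scA \<rho> d A E As Es"
    and "parameter_array scA \<rho> d A E As Es \<theta> \<theta>s vphi phi"
    and "antiautomorphism scA dag" and "dag A = A" and "dag As = As"
    and "bilinear_form scV bf" and "\<exists>u v. bf u v \<noteq> 0"
    and "\<And>X u v. bf (act X u) v = bf u (act (dag X) v)"
    and "\<xi>0 \<in> range (act (E 0))" and "\<xi>0 \<noteq> 0"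
    and "\<xi>d \<in> range (act (E d))" and "\<xi>d \<noteq> 0"
    and "\<xi>s0 \<in> range (act (Es 0))" and "\<xi>s0 \<noteq> 0"
    and "\<xi>sd \<in> range (act (Es d))" and "\<xi>sd \<noteq> 0"
  shows
    "(\<forall>X \<in> {E, \<lambda>i. E (d - i),
          \<lambda>i. poly_alg scA (tau_poly \<theta> i) A,
          \<lambda>i. poly_alg scA (tau_poly \<theta> (d - i)) A,
          \<lambda>i. poly_alg scA (eta_poly d \<theta> i) A,
          \<lambda>i. poly_alg scA (eta_poly d \<theta> (d - i)) A}.
       \<forall>i\<le>d.
         act (scA (bf \<xi>s0 \<xi>s0 / bf \<xi>0 \<xi>s0)
            (\<Sum>r = 0..d. scA (inverse (\<Prod>k = 1..r. vphi k)) (X r * Es 0 * poly_alg scA (tau_poly \<theta> r) A)))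
           (act (poly_alg scA (tau_poly \<theta>s i) As) \<xi>0) = act (X i) \<xi>s0 \<and>
         act (scA (poly (tau_poly \<theta> d) (\<theta> d) / (\<Prod>k = 1..d. phi k) * (bf \<xi>sd \<xi>sd / bf \<xi>0 \<xi>sd))
            (\<Sum>r = 0..d. X r * Es d * E d * poly_alg scA (eta_poly d \<theta>s (d - r)) As))
           (act (poly_alg scA (tau_poly \<theta>s i) As) \<xi>0) = act (X i) \<xi>sd \<and>
         act (scA (bf \<xi>s0 \<xi>s0 / bf \<xi>0 \<xi>s0)
            (\<Sum>r = 0..d. scA (inverse (\<Prod>k = 1..r. vphi k)) (X (d - r) * Es 0 * poly_alg scA (tau_poly \<theta> r) A)))
           (act (poly_alg scA (tau_poly \<theta>s (d - i)) As) \<xi>0) = act (X i) \<xi>s0 \<and>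
         act (scA (poly (tau_poly \<theta> d) (\<theta> d) / (\<Prod>k = 1..d. phi k) * (bf \<xi>sd \<xi>sd / bf \<xi>0 \<xi>sd))
            (\<Sum>r = 0..d. X (d - r) * Es d * E d * poly_alg scA (eta_poly d \<theta>s (d - r)) As))
           (act (poly_alg scA (tau_poly \<theta>s (d - i)) As) \<xi>0) = act (X i) \<xi>sd) \<and>
     (\<forall>X \<in> {Es, \<lambda>i. Es (d - i),
          \<lambda>i. poly_alg scA (tau_poly \<theta>s i) As,
          \<lambda>i. poly_alg scA (tau_poly \<theta>s (d - i)) As,
          \<lambda>i. poly_alg scA (eta_poly d \<theta>s i) As,
          \<lambda>i. poly_alg scA (eta_poly d \<theta>s (d - i)) As}.
       \<forall>i\<le>d.
         act (scA (1 / tr \<rho> (E 0 * Es 0))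
            (\<Sum>r = 0..d. scA (inverse (\<Prod>k = 1..r. vphi k)) (X r * E 0 * Es 0 * poly_alg scA (tau_poly \<theta> r) A)))
           (act (poly_alg scA (tau_poly \<theta>s i) As) \<xi>0) = act (X i) \<xi>0 \<and>
         act (scA (poly (tau_poly \<theta> d) (\<theta> d) / (\<Prod>k = 1..d. vphi k) * (bf \<xi>d \<xi>s0 / bf \<xi>0 \<xi>s0))
            (\<Sum>r = 0..d. X r * E d * poly_alg scA (eta_poly d \<theta>s (d - r)) As))
           (act (poly_alg scA (tau_poly \<theta>s i) As) \<xi>0) = act (X i) \<xi>d \<and>
         act (scA (1 / tr \<rho> (E 0 * Es 0))
            (\<Sum>r = 0..d. scA (inverse (\<Prod>k = 1..r. vphi k)) (X (d - r) * E 0 * Es 0 * poly_alg scA (tau_poly \<theta> r) A)))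
           (act (poly_alg scA (tau_poly \<theta>s (d - i)) As) \<xi>0) = act (X i) \<xi>0 \<and>
         act (scA (poly (tau_poly \<theta> d) (\<theta> d) / (\<Prod>k = 1..d. vphi k) * (bf \<xi>d \<xi>s0 / bf \<xi>0 \<xi>s0))
            (\<Sum>r = 0..d. X (d - r) * E d * poly_alg scA (eta_poly d \<theta>s (d - r)) As))
           (act (poly_alg scA (tau_poly \<theta>s (d - i)) As) \<xi>0) = act (X i) \<xi>d)"
  (is "(\<forall>X\<in>_. \<forall>i\<le>d. ?P X i) \<and> (\<forall>X\<in>_. \<forall>i\<le>d. ?Q X i)")
proof -
  interpret irreducible_algebra_module scA scV act by fact
  note LS = assms(4)[unfolded leonard_system_def]
  note PA = assms(5)[unfolded parameter_array_def]
  have R: "rank_one_resolution scA (tr \<rho>) d A E \<theta>"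
    by (rule prim_idem_resolution[OF assms(1,2)]) (use LS PA in blast)+
  have Rs: "rank_one_resolution scA (tr \<rho>) d As Es \<theta>s"
    by (rule prim_idem_resolution[OF assms(1,2)]) (use LS PA in blast)+
  have tri: "irreducible_tridiagonal d E As" "irreducible_tridiagonal d Es A"
    using LS unfolding irreducible_tridiagonal_def by blast+
  have LP: "leonard_pair scA (tr \<rho>) d A E \<theta> As Es \<theta>s"
    using R Rs tri by (simp add: leonard_pair_def leonard_pair_axioms_def)
  then interpret leonard_pair scA "tr \<rho>" d A E \<theta> As Es \<theta>s .
  have fixed: "act F \<xi> = \<xi>" if "F * F = F" "\<xi> \<in> range (act F)" for F \<xi>
    using that act_mult[of F F] by auto
  interpret leonard_form scA scV act dag bf "tr \<rho>" d A E \<theta> As Es \<theta>s vphi phi \<xi>0 \<xi>d \<xi>s0 \<xi>sd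
  proof (unfold_locales)
    show "dag (E i) = E i" "dag (Es i) = Es i" if "i \<le> d" for i
    proof -
      have "E i = prim_idem scA \<rho> A (\<theta> i)" "Es i = prim_idem scA \<rho> As (\<theta>s i)"
        using PA that by blast+
      then show "dag (E i) = E i" "dag (Es i) = Es i"
        unfolding prim_idem_def
        by (simp_all only: dag_poly_alg[OF assms(6,7)] dag_poly_alg[OF assms(6,8)])
    qed
    show "vphi i = (\<theta>s 0 - \<theta>s i) *
        (tr \<rho> (pA (tau_poly \<theta> i) * Es 0) / tr \<rho> (pA (tau_poly \<theta> (i - 1)) * Es 0))"
      "phi i = (\<theta>s 0 - \<theta>s i) *
        (tr \<rho> (pA (eta_poly d \<theta> i) * Es 0) / tr \<rho> (pA (eta_poly d \<theta> (i - 1)) * Es 0))"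
      if "i \<in> {1..d}" for i
      using PA that by blast+
    show "act (E 0) \<xi>0 = \<xi>0" "act (E d) \<xi>d = \<xi>d" "act (Es 0) \<xi>s0 = \<xi>s0" "act (Es d) \<xi>sd = \<xi>sd"
      using fixed[OF _ assms(12)] fixed[OF _ assms(14)] fixed[OF _ assms(16)] fixed[OF _ assms(18)]
      by (simp_all add: L.orthogonal S.orthogonal)
  qed (rule assms(9,10,11,13,15,17,19))+
  \<comment> \<open>The last two identities of each part are the first two for the reversed sequence \<open>X\<close>
    at the index \<open>d - i\<close>.\<close>
  have P: "?P X i" if "i \<le> d" for X i
    using transition_star_0[OF that, of X] transition_star_d[OF that, of X]
      transition_star_0[of "d - i" "\<lambda>r. X (d - r)", OF diff_le_self, unfolded diff_diff_cancel[OF that]]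
      transition_star_d[of "d - i" "\<lambda>r. X (d - r)", OF diff_le_self, unfolded diff_diff_cancel[OF that]]
    by (intro conjI)
  have Q: "?Q X i" if "i \<le> d" for X i
    using transition_0[OF that, of X] transition_d[OF that, of X]
      transition_0[of "d - i" "\<lambda>r. X (d - r)", OF diff_le_self, unfolded diff_diff_cancel[OF that]]
      transition_d[of "d - i" "\<lambda>r. X (d - r)", OF diff_le_self, unfolded diff_diff_cancel[OF that]]
    by (intro conjI)
  show ?thesis
  proof (rule conjI; rule ballI; rule allI; rule impI)
    fix X i
    assume "i \<le> d"
    then show "?P X i" "?Q X i" by (rule P, rule Q)
  qed
qed

end
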